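(* Let $P=P(m_1,\dots,m_{n-1})$ be a natural unit interval order on $[n]$ and let $G=\mathrm{inc}(P)$. Suppose $m_1=r<n$ and $m_{r+1}=n$. Then there is a positive integer $k$ such that $$X_G(\mathbf{x},t)=\sum_{\ell=0}^{k}C_{(n-\ell,\ell)}(t)\,e_{(n-\ell,\ell)},\qquad C_{(n-\ell,\ell)}(t)=\sum_{T\in\overline{\mathcal{T}'}_{P,2^\ell1^{n-2\ell}}}t^{\mathrm{inv}_G(T)},$$ where $\overline{\mathcal{T}'}_{P,2^\ell1^{n-2\ell}}$ is the set of $P$-tableaux $T=[a_{i,j}]$ of shape $2^\ell1^{n-2\ell}$ for which there is no $s\ge \ell+2$ such that $a_{i,1}<_P a_{s,1}$ for all $i\in\{\ell+1,\ell+2,\dots,s-1\}$. Consequently $X_G(\mathbf{x},t)$ is $e$-positive, i.e. each $C_{(n-\ell,\ell)}(t)$ has nonnegative coefficients.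
   Context: A natural unit interval order $P(m_1,\dots,m_{n-1})$ is defined for integers $m_1\le\cdots\le m_{n-1}\le n$ with $m_i\ge i$: it is the poset on $[n]$ with $i<_P j$ iff $i<n$ and $j\in\{m_i+1,\dots,n\}$. Its incomparability graph $\mathrm{inc}(P)$ has vertex set $[n]$ and an edge $\{i,j\}$ ($i<j$) iff $j\le m_i$. The chromatic quasisymmetric function of a graph $G$ on $V\subset\mathbb{P}$ is $X_G(\mathbf{x},t)=\sum_\kappa t^{\mathrm{asc}(\kappa)}\prod_{v}x_{\kappa(v)}$ over proper colorings $\kappa:V\to\mathbb{P}$, with $\mathrm{asc}(\kappa)$ the number of edges $\{i,j\}$, $i<j$, with $\kappa(i)<\kappa(j)$. $e_\lambda=e_{\lambda_1}e_{\lambda_2}\cdots$ is the elementary symmetric function, with $e_{(n,0)}=e_n$. A $P$-tableau of shape $\lambda\vdash n$ is a filling $T=[a_{i,j}]$ of the Young diagram of $\lambda$ (English notation, $a_{i,j}$ in row $i$, column $j$) using each element of $P$ exactly once, such that $a_{i,j}<_P a_{i,j+1}$ for all $i,j$ and $a_{i+1,j}\not<_P a_{i,j}$ for all $i,j$. The shape $2^\ell1^{n-2\ell}$ has $\ell$ rows of length $2$ followed by $n-2\ell$ rows of length $1$. For $G=\mathrm{inc}(P)$ and a $P$-tableau $T$, a $G$-inversion of $T$ is an edge $\{i,j\}$ of $G$ with $i<j$ and $i$ in a lower row than $j$ in $T$; $\mathrm{inv}_G(T)$ is the number of $G$-inversions. *)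

theory Defs
  imports "HOL-Library.FuncSet" "HOL-Computational_Algebra.Polynomial"
begin

text \<open>The natural unit interval order P(m_1,...,m_{n-1}) on [n] = {1..n}, with the
  sequence m given as a function nat => nat (only the values m 1, ..., m (n-1) matter):
  i <_P j iff i < n and j in {m_i+1..n}.\<close>
definition nuio_less :: "(nat \<Rightarrow> nat) \<Rightarrow> nat \<Rightarrow> nat \<Rightarrow> nat \<Rightarrow> bool" where
  "nuio_less m n i j \<longleftrightarrow> i \<in> {1..n} \<and> i < n \<and> j \<in> {m i + 1..n}"

definition inc_edge :: "(nat \<Rightarrow> nat) \<Rightarrow> nat \<Rightarrow> nat \<Rightarrow> nat \<Rightarrow> bool" where
  "inc_edge m n i j \<longleftrightarrow> i \<in> {1..n} \<and> j \<in> {1..n} \<and> i < j \<and> j \<le> m i"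

text \<open>A graph on vertex set V (subset of the positive integers) is given by its edge
  predicate E on ordered pairs (i,j) with i < j. Formal power series in x_1, x_2, ...
  are represented by their coefficient functions: a monomial prod_c x_c^(alpha c) is an
  exponent function alpha :: nat => nat of finite support; coefficients lie in Z[t].\<close>

definition proper_coloring :: "nat set \<Rightarrow> (nat \<Rightarrow> nat \<Rightarrow> bool) \<Rightarrow> (nat \<Rightarrow> nat) \<Rightarrow> bool" where
  "proper_coloring V E \<kappa> \<longleftrightarrow> \<kappa> \<in> V \<rightarrow>\<^sub>E {1..} \<and> (\<forall>i j. E i j \<longrightarrow> \<kappa> i \<noteq> \<kappa> j)"

definition asc :: "(nat \<Rightarrow> nat \<Rightarrow> bool) \<Rightarrow> (nat \<Rightarrow> nat) \<Rightarrow> nat" where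
  "asc E \<kappa> = card {(i, j). E i j \<and> \<kappa> i < \<kappa> j}"

definition colorings_with_content ::
    "nat set \<Rightarrow> (nat \<Rightarrow> nat \<Rightarrow> bool) \<Rightarrow> (nat \<Rightarrow> nat) \<Rightarrow> (nat \<Rightarrow> nat) set" where
  "colorings_with_content V E \<alpha> =
     {\<kappa>. proper_coloring V E \<kappa> \<and> (\<forall>c. card {v \<in> V. \<kappa> v = c} = \<alpha> c)}"

definition chrom_qsym_coeff :: "nat set \<Rightarrow> (nat \<Rightarrow> nat \<Rightarrow> bool) \<Rightarrow> (nat \<Rightarrow> nat) \<Rightarrow> int poly" where
  "chrom_qsym_coeff V E \<alpha> = (\<Sum>\<kappa> \<in> colorings_with_content V E \<alpha>. monom 1 (asc E \<kappa>))"

text \<open>e_k = sum over k-subsets S of the positive integers of prod_{c in S} x_c, and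
  e_lambda = e_{lambda_1} e_{lambda_2} ...; so the coefficient of x^alpha in e_lambda is the
  number of tuples (S_1,...,S_r) of finite sets of positive integers with |S_i| = lambda_i
  and alpha c = #{i. c in S_i} for all c.\<close>
definition e_coeff :: "nat list \<Rightarrow> (nat \<Rightarrow> nat) \<Rightarrow> nat" where
  "e_coeff sh \<alpha> = card {Ss. length Ss = length sh \<and>
      (\<forall>i < length sh. Ss ! i \<subseteq> {1..} \<and> finite (Ss ! i) \<and> card (Ss ! i) = sh ! i) \<and>
      (\<forall>c. \<alpha> c = (\<Sum>i < length sh. of_bool (c \<in> Ss ! i)))}"

text \<open>Young diagram (English notation) of a shape given by its list of row lengths;
  cell (i,j) is row i, column j, both 1-based.\<close>
definition young_cells :: "nat list \<Rightarrow> (nat \<times> nat) set" where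
  "young_cells sh = {(i, j). 1 \<le> i \<and> i \<le> length sh \<and> 1 \<le> j \<and> j \<le> sh ! (i - 1)}"

definition shape_21 :: "nat \<Rightarrow> nat \<Rightarrow> nat list" where
  "shape_21 n l = replicate l 2 @ replicate (n - 2 * l) 1"

definition P_tableau :: "(nat \<Rightarrow> nat) \<Rightarrow> nat \<Rightarrow> nat list \<Rightarrow> (nat \<times> nat \<Rightarrow> nat) \<Rightarrow> bool" where
  "P_tableau m n sh T \<longleftrightarrow>
     T \<in> young_cells sh \<rightarrow>\<^sub>E {1..n} \<and>
     bij_betw T (young_cells sh) {1..n} \<and>
     (\<forall>i j. (i, j) \<in> young_cells sh \<and> (i, j + 1) \<in> young_cells sh \<longrightarrow>
              nuio_less m n (T (i, j)) (T (i, j + 1))) \<and>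
     (\<forall>i j. (i, j) \<in> young_cells sh \<and> (i + 1, j) \<in> young_cells sh \<longrightarrow>
              \<not> nuio_less m n (T (i + 1, j)) (T (i, j)))"

definition inv_G :: "(nat \<Rightarrow> nat) \<Rightarrow> nat \<Rightarrow> nat list \<Rightarrow> (nat \<times> nat \<Rightarrow> nat) \<Rightarrow> nat" where
  "inv_G m n sh T = card {(u, v). inc_edge m n u v \<and>
     (\<exists>i j i' j'. (i, j) \<in> young_cells sh \<and> (i', j') \<in> young_cells sh \<and>
        T (i, j) = u \<and> T (i', j') = v \<and> i' < i)}"

definition tableaux_bar :: "(nat \<Rightarrow> nat) \<Rightarrow> nat \<Rightarrow> nat \<Rightarrow> (nat \<times> nat \<Rightarrow> nat) set" where
  "tableaux_bar m n l = {T. P_tableau m n (shape_21 n l) T \<and>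
     \<not> (\<exists>s. l + 2 \<le> s \<and> s \<le> length (shape_21 n l) \<and>
            (\<forall>i \<in> {l + 1..<s}. nuio_less m n (T (i, 1)) (T (s, 1))))}"

definition C_coeff :: "(nat \<Rightarrow> nat) \<Rightarrow> nat \<Rightarrow> nat \<Rightarrow> int poly" where
  "C_coeff m n l = (\<Sum>T \<in> tableaux_bar m n l. monom 1 (inv_G m n (shape_21 n l) T))"

end

theory Submission
  imports Defs "HOL-Combinatorics.Multiset_Permutations"
begin

text \<open>
  Since \<open>m\<^sub>1 = r\<close> and \<open>m\<^bsub>r+1\<^esub> = n\<close>, both \<open>{1..r}\<close> and \<open>{r+1..n}\<close> are cliques of
  the incomparability graph, so chains of \<open>P\<close> have at most two elements. Colorings and tableaux
  are read as permutations of \<open>[n]\<close> by listing color classes from the largest color (rows from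
  the top), each one decreasingly; the statistics then count edges \<open>i < j\<close> with \<open>j\<close> before \<open>i\<close>.

  A local bijection on three consecutive letters exchanges a two-element class with an adjacent
  singleton, so the weight \<open>W(d, p, q)\<close> of the words made of \<open>d\<close> pairs, \<open>p\<close> singletons and a final
  stretch of \<open>q\<close> letters without descents in \<open>P\<close> does not depend on the order of the pairs and
  singletons. A last singleton either extends the descent-free stretch or forms a pair with its
  first letter: \<open>W(d, p + 1, q + 1) = W(d, p, q + 2) + W(d + 1, p, q)\<close>. This is the recursion of
  \<open>e\<^sub>2\<^sup>d e\<^sub>1\<^sup>p h\<^sub>q\<close> in two variables. The words with \<open>p = 0\<close> are the \<open>P\<close>-tableaux of shape
  \<open>2\<^sup>d1\<^bsup>n-2d\<^esup>\<close>, and \<open>W(d, 0, n - 2d) = C\<^sub>d + W(d + 1, 0, n - 2d - 2)\<close>, because in a tableau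
  with a forbidden \<open>s\<close> the entry of row \<open>s\<close> can be moved up next to the entry of row \<open>d + 1\<close>
  without crossing an edge. Hence the coefficient \<open>W(d, n - 2d, 0)\<close> of \<open>x\<^sup>\<alpha>\<close>, where \<open>d\<close> colors are
  used twice, is \<open>\<Sum>\<^sub>l binom(n-2d, l-d) C\<^sub>l\<close>, and \<open>binom(n-2d, l-d)\<close> is the coefficient of
  \<open>x\<^sup>\<alpha>\<close> in \<open>e\<^bsub>(n-l,l)\<^esub>\<close>.
\<close>

section \<open>Inversions and adjacent swaps\<close>

fun inversions :: "('a \<Rightarrow> 'a \<Rightarrow> bool) \<Rightarrow> 'a list \<Rightarrow> nat" where
  "inversions E [] = 0"
| "inversions E (x # xs) = length (filter (\<lambda>y. E y x) xs) + inversions E xs"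

lemma inversions_append:
  "inversions E (xs @ ys) =
     inversions E xs + inversions E ys + (\<Sum>x\<leftarrow>xs. length (filter (\<lambda>y. E y x) ys))"
  by (induction xs) auto

lemma inversions_infix_cong:
  assumes "mset ys = mset zs" "inversions E ys = inversions E zs"
  shows "inversions E (xs @ ys @ ws) = inversions E (xs @ zs @ ws)"
proof -
  have "length (filter P ys) = length (filter P zs)" for P
    using assms(1) by (metis mset_filter size_mset)
  moreover have "sum_list (map f ys) = sum_list (map f zs)" for f :: "'a \<Rightarrow> nat"
    using assms(1) by (metis mset_map sum_mset_sum_list)
  ultimately show ?thesis
    using assms(2) by (simp add: inversions_append)
qed

lemma distinct_if_sorted_wrt:
  assumes "sorted_wrt R xs" "asymp R"
  shows "distinct xs"
  using assms by (induction xs) (auto dest: asympD)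

lemma inversions_map_sorted_wrt:
  assumes "sorted_wrt R cs" and R: "asymp R"
  shows "inversions E (map f cs) =
    card {(c, d). c \<in> set cs \<and> d \<in> set cs \<and> R d c \<and> E (f c) (f d)}"
  using assms(1)
proof (induction cs)
  case Nil
  then show ?case by simp
next
  case (Cons d cs)
  let ?S = "\<lambda>cs. {(c, d). c \<in> set cs \<and> d \<in> set cs \<and> R d c \<and> E (f c) (f d)}"
  let ?D = "{c \<in> set cs. E (f c) (f d)}"
  have sorted: "sorted_wrt R cs" and above: "\<And>c. c \<in> set cs \<Longrightarrow> R d c"
    using Cons.prems by auto
  have "length (filter (\<lambda>c. E (f c) (f d)) cs) = card (set (filter (\<lambda>c. E (f c) (f d)) cs))"
    using distinct_if_sorted_wrt[OF sorted R] by (metis distinct_card distinct_filter)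
  also have "\<dots> = card ((\<lambda>c. (c, d)) ` ?D)"
    by (simp add: card_image inj_on_def)
  finally have head: "length (filter (\<lambda>c. E (f c) (f d)) cs) = card ((\<lambda>c. (c, d)) ` ?D)" .
  have "?S (d # cs) = (\<lambda>c. (c, d)) ` ?D \<union> ?S cs"
    using above asympD[OF R] by auto
  moreover have "((\<lambda>c. (c, d)) ` ?D) \<inter> ?S cs = {}"
    using above asympD[OF R] by auto
  moreover have "finite (?S cs)"
    by (rule finite_subset[of _ "set cs \<times> set cs"]) auto
  ultimately show ?case
    using head Cons.IH[OF sorted] by (simp add: card_Un_disjoint comp_def filter_map)
qed

lemma eq_if_adjacent_swap_invariant:
  assumes swap: "\<And>u x y v. f (u @ x # y # v) = f (u @ y # x # v)" and "mset xs = mset ys"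
  shows "f xs = f ys"
proof -
  have move: "f (u @ x # v @ w) = f (u @ v @ x # w)" for u x v w
  proof (induction v arbitrary: u)
    case (Cons y v)
    then show ?case
      using swap[of u x y "v @ w"] Cons.IH[of "u @ [y]"] by simp
  qed simp
  have "f (u @ xs) = f (u @ ys)" for u
    using assms(2)
  proof (induction xs arbitrary: u ys)
    case (Cons x xs)
    then obtain v w where ys: "ys = v @ x # w"
      by (metis list.set_intros(1) mset_eq_setD split_list)
    then have "f ((u @ [x]) @ xs) = f ((u @ [x]) @ v @ w)"
      using Cons.prems by (intro Cons.IH) simp
    then show ?case
      using move[of u x v w] ys by simp
  qed simp
  from this[of "[]"] show ?thesis by simp
qed

section \<open>Concatenation of sets of words\<close>

definition conc :: "'a list set \<Rightarrow> 'a list set \<Rightarrow> 'a list set" (infixr "\<odot>" 75) where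
  "A \<odot> B = {xs @ ys | xs ys. xs \<in> A \<and> ys \<in> B}"

definition conc_list :: "'a list set list \<Rightarrow> 'a list set" where
  "conc_list As = foldr (\<odot>) As {[]}"

lemma append_in_conc: "xs \<in> A \<Longrightarrow> ys \<in> B \<Longrightarrow> xs @ ys \<in> A \<odot> B"
  by (auto simp: conc_def)

lemma conc_assoc: "(A \<odot> B) \<odot> C = A \<odot> B \<odot> C"
  unfolding conc_def by (simp add: set_eq_iff) (metis append.assoc)

lemma conc_Nil [simp]: "A \<odot> {[]} = A" "{[]} \<odot> A = A"
  by (auto simp: conc_def)

lemma conc_empty [simp]: "A \<odot> {} = {}" "{} \<odot> A = {}"
  by (auto simp: conc_def)

lemma conc_Un: "A \<odot> (M \<union> N) = A \<odot> M \<union> A \<odot> N"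
  by (auto simp: conc_def)

lemma conc_list_Nil [simp]: "conc_list [] = {[]}"
  and conc_list_Cons [simp]: "conc_list (A # As) = A \<odot> conc_list As"
  by (auto simp: conc_list_def)

lemma conc_list_append [simp]: "conc_list (As @ Bs) = conc_list As \<odot> conc_list Bs"
  by (induction As) (auto simp: conc_assoc)

lemma conc_fixed_length_iff:
  assumes "\<forall>xs\<in>A. length xs = p"
  shows "xs \<in> A \<odot> B \<longleftrightarrow> take p xs \<in> A \<and> drop p xs \<in> B"
proof
  assume "take p xs \<in> A \<and> drop p xs \<in> B"
  then show "xs \<in> A \<odot> B"
    using append_in_conc by fastforce
qed (use assms in \<open>auto simp: conc_def\<close>)

lemma conc_disjoint:
  assumes "\<forall>xs\<in>A. length xs = p" "M \<inter> N = {}"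
  shows "(A \<odot> M) \<inter> (A \<odot> N) = {}"
  using assms(2) by (auto simp: conc_fixed_length_iff[OF assms(1)])

lemma conc_list_map_iff:
  assumes "distinct cs"
  shows "xs \<in> conc_list (map A cs) \<longleftrightarrow> (\<exists>\<rho>. (\<forall>c\<in>set cs. \<rho> c \<in> A c) \<and> xs = concat (map \<rho> cs))"
  using assms
proof (induction cs arbitrary: xs)
  case Nil
  then show ?case by simp
next
  case (Cons c cs)
  show ?case
  proof
    assume "xs \<in> conc_list (map A (c # cs))"
    then obtain y \<rho> where "y \<in> A c" "\<forall>c\<in>set cs. \<rho> c \<in> A c" "xs = y @ concat (map \<rho> cs)"
      using Cons by (auto simp: conc_def)
    moreover have "map (\<rho>(c := y)) cs = map \<rho> cs"
      using Cons.prems by auto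
    ultimately show "\<exists>\<rho>. (\<forall>c\<in>set (c # cs). \<rho> c \<in> A c) \<and> xs = concat (map \<rho> (c # cs))"
      using Cons.prems by (intro exI[of _ "\<rho>(c := y)"]) auto
  next
    assume "\<exists>\<rho>. (\<forall>c\<in>set (c # cs). \<rho> c \<in> A c) \<and> xs = concat (map \<rho> (c # cs))"
    then show "xs \<in> conc_list (map A (c # cs))"
      using Cons by (auto intro!: append_in_conc)
  qed
qed

section \<open>Symmetric polynomials in two variables\<close>

text \<open>Symmetric polynomials are evaluated at \<open>(1, y)\<close>, so that \<open>e\<^sub>1 = 1 + y\<close> and \<open>e\<^sub>2 = y\<close>.\<close>

definition complete_homogeneous :: "nat \<Rightarrow> int poly" where
  "complete_homogeneous q = (\<Sum>i\<le>q. monom 1 i)"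

lemma coeff_complete_homogeneous: "coeff (complete_homogeneous q) i = of_bool (i \<le> q)"
  by (auto simp: complete_homogeneous_def coeff_sum)

lemma one_plus_X_mult_complete_homogeneous:
  "[:1, 1:] * complete_homogeneous (Suc q) =
     complete_homogeneous (Suc (Suc q)) + [:0, 1:] * complete_homogeneous q" (is "?p = ?q")
proof (rule poly_eqI)
  fix i
  show "coeff ?p i = coeff ?q i"
    by (cases i) (auto simp: coeff_complete_homogeneous)
qed

definition e2_e1_h :: "nat \<Rightarrow> nat \<Rightarrow> nat \<Rightarrow> int poly" where
  "e2_e1_h d p q = [:0, 1:] ^ d * [:1, 1:] ^ p * complete_homogeneous q"

lemma e2_e1_h_0: "e2_e1_h d p 0 = [:0, 1:] ^ d * [:1, 1:] ^ p"
  by (simp add: e2_e1_h_def complete_homogeneous_def)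

lemma e2_e1_h_Suc_0: "e2_e1_h d (Suc p) 0 = e2_e1_h d p (Suc 0)"
proof -
  have "complete_homogeneous (Suc 0) = [:1, 1:]"
    by (simp add: complete_homogeneous_def monom_altdef one_pCons)
  then show ?thesis
    unfolding e2_e1_h_0 unfolding e2_e1_h_def by (simp only: power_Suc mult_ac)
qed

lemma e2_e1_h_Suc_Suc: "e2_e1_h d (Suc p) (Suc q) = e2_e1_h d p (Suc (Suc q)) + e2_e1_h (Suc d) p q"
proof -
  have "e2_e1_h d (Suc p) (Suc q) =
      [:0, 1:] ^ d * [:1, 1:] ^ p * ([:1, 1:] * complete_homogeneous (Suc q))"
    by (simp only: e2_e1_h_def power_Suc mult_ac)
  also have "\<dots> = e2_e1_h d p (Suc (Suc q)) + e2_e1_h (Suc d) p q"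
    unfolding one_plus_X_mult_complete_homogeneous
    by (simp only: e2_e1_h_def power_Suc ring_distribs mult_ac)
  finally show ?thesis .
qed

lemma coeff_e2_h: "coeff (e2_e1_h d 0 q) l = of_bool (d \<le> l \<and> l \<le> d + q)"
proof -
  have "e2_e1_h d 0 q = monom 1 d * complete_homogeneous q"
    by (simp add: e2_e1_h_def monom_altdef)
  then show ?thesis
    by (auto simp: coeff_monom_mult coeff_complete_homogeneous)
qed

section \<open>Coefficients of elementary symmetric functions\<close>

definition two_column_content :: "nat \<Rightarrow> (nat \<Rightarrow> nat) \<Rightarrow> bool" where
  "two_column_content N \<alpha> \<longleftrightarrow> \<alpha> 0 = 0 \<and> (\<forall>c. \<alpha> c \<le> 2) \<and> (\<Sum>c | \<alpha> c \<noteq> 0. \<alpha> c) = N"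

lemma two_column_content_cases:
  assumes "two_column_content N \<alpha>"
  obtains "\<alpha> c = 0" | "\<alpha> c = 1" | "\<alpha> c = 2"
proof -
  have "\<alpha> c \<le> 2"
    using assms by (simp add: two_column_content_def)
  then show ?thesis
    using that by linarith
qed

lemma sum_two_indicators:
  assumes "finite S" "finite T" and \<alpha>: "\<And>c. \<alpha> c = of_bool (c \<in> S) + of_bool (c \<in> T)"
  shows "(\<Sum>c | \<alpha> c \<noteq> (0 :: nat). \<alpha> c) = card S + card T"
proof -
  have "(\<Sum>c | \<alpha> c \<noteq> 0. \<alpha> c) = (\<Sum>c \<in> S \<union> T. \<alpha> c)"
    by (rule sum.mono_neutral_left) (use assms in auto)
  also have "\<dots> = (\<Sum>c \<in> S \<union> T. of_bool (c \<in> S)) + (\<Sum>c \<in> S \<union> T. of_bool (c \<in> T))"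
    by (simp add: \<alpha> sum.distrib)
  also have "\<dots> = card S + card T"
    using assms(1,2) by (simp add: Int_absorb1 Int_absorb2 Collect_mem_eq Int_Un_distrib2)
  finally show ?thesis .
qed

definition indicator_pairs :: "nat \<Rightarrow> nat \<Rightarrow> (nat \<Rightarrow> nat) \<Rightarrow> (nat set \<times> nat set) set" where
  "indicator_pairs k l \<alpha> = {(S, T). S \<subseteq> {1..} \<and> T \<subseteq> {1..} \<and> finite S \<and> finite T \<and>
     card S = k \<and> card T = l \<and> (\<forall>c. \<alpha> c = of_bool (c \<in> S) + of_bool (c \<in> T))}"

lemma e_coeff_eq_card_indicator_pairs: "e_coeff [k, l] \<alpha> = card (indicator_pairs k l \<alpha>)"
proof -
  have "{Ss. length Ss = length [k, l] \<and>
      (\<forall>i < length [k, l]. Ss ! i \<subseteq> {1..} \<and> finite (Ss ! i) \<and> card (Ss ! i) = [k, l] ! i) \<and>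
      (\<forall>c. \<alpha> c = (\<Sum>i < length [k, l]. of_bool (c \<in> Ss ! i)))} =
      (\<lambda>(S, T). [S, T]) ` indicator_pairs k l \<alpha>"
    by (auto simp: indicator_pairs_def length_Suc_conv All_less_Suc2 image_iff)
  moreover have "inj_on (\<lambda>(S, T). [S, T]) (indicator_pairs k l \<alpha>)"
    by (auto simp: inj_on_def)
  ultimately show ?thesis
    unfolding e_coeff_def by (simp only: card_image)
qed

lemma two_column_content_if_e_coeff:
  assumes "e_coeff [k, l] \<alpha> \<noteq> 0"
  shows "two_column_content (k + l) \<alpha>"
proof -
  obtain S T where ST: "S \<subseteq> {1..}" "T \<subseteq> {1..}" "finite S" "finite T" "card S = k" "card T = l"
    and \<alpha>: "\<And>c. \<alpha> c = of_bool (c \<in> S) + of_bool (c \<in> T)"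
    using assms unfolding e_coeff_eq_card_indicator_pairs
    by (auto simp: indicator_pairs_def card_eq_0_iff)
  have "\<alpha> 0 = 0" "\<alpha> c \<le> 2" for c
    using ST by (auto simp: \<alpha>)
  then show ?thesis
    using sum_two_indicators[OF ST(3,4) \<alpha>] ST by (simp add: two_column_content_def)
qed

lemma e_coeff_eq_card_subsets:
  assumes \<alpha>: "two_column_content (k + l) \<alpha>" and fin: "finite {c. \<alpha> c \<noteq> 0}"
  shows "e_coeff [k, l] \<alpha> = card {T. {c. \<alpha> c = 2} \<subseteq> T \<and> T \<subseteq> {c. \<alpha> c \<noteq> 0} \<and> card T = l}"
proof -
  let ?W = "{c. \<alpha> c = 2}" and ?C = "{c. \<alpha> c \<noteq> 0}"
  let ?T = "{T. ?W \<subseteq> T \<and> T \<subseteq> ?C \<and> card T = l}" and ?pair = "\<lambda>T. (?W \<union> (?C - T), T)"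
  have "indicator_pairs k l \<alpha> = ?pair ` ?T"
  proof (intro equalityI subsetI)
    fix ST assume "ST \<in> indicator_pairs k l \<alpha>"
    then obtain S T where ST: "ST = (S, T)" "card T = l"
      and indicator: "\<And>c. \<alpha> c = of_bool (c \<in> S) + of_bool (c \<in> T)"
      by (auto simp: indicator_pairs_def)
    then have "ST = ?pair T" "T \<in> ?T"
      by (auto simp: indicator)
    then show "ST \<in> ?pair ` ?T" by blast
  next
    fix ST assume "ST \<in> ?pair ` ?T"
    then obtain S T where ST: "ST = (S, T)" and S: "S = ?W \<union> (?C - T)"
      and T: "?W \<subseteq> T" "T \<subseteq> ?C" "card T = l" by blast
    have indicator: "\<alpha> c = of_bool (c \<in> S) + of_bool (c \<in> T)" for c
      by (rule two_column_content_cases[OF \<alpha>, of c]) (use S T in auto)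
    have "S \<subseteq> ?C"
      using S by auto
    then have finite: "finite S" "finite T"
      using T(2) finite_subset[OF _ fin] by auto
    have "card S = k"
      using sum_two_indicators[OF finite indicator] \<alpha> T(3) by (simp add: two_column_content_def)
    moreover have "?C \<subseteq> {1..}"
      using \<alpha> by (auto simp: two_column_content_def Suc_le_eq intro!: gr0I)
    ultimately show "ST \<in> indicator_pairs k l \<alpha>"
      unfolding indicator_pairs_def using ST T(2,3) finite indicator \<open>S \<subseteq> ?C\<close> by blast
  qed
  moreover have "inj_on ?pair ?T"
    by (auto simp: inj_on_def)
  ultimately show ?thesis
    unfolding e_coeff_eq_card_indicator_pairs by (simp only: card_image)
qed

lemma card_subsets_between:
  assumes "finite B" "A \<subseteq> B"
  shows "card {T. A \<subseteq> T \<and> T \<subseteq> B \<and> card T = card A + k} = (card B - card A) choose k"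
proof -
  let ?U = "{U. U \<subseteq> B - A \<and> card U = k}" and ?T = "{T. A \<subseteq> T \<and> T \<subseteq> B \<and> card T = card A + k}"
  have A: "finite A" using assms finite_subset by blast
  have "card (A \<union> U) = card A + card U" if "U \<subseteq> B - A" for U
    using that assms(1) A by (intro card_Un_disjoint) (auto intro: finite_subset)
  then have "bij_betw ((\<union>) A) ?U ?T"
    using assms(2) A
    by (intro bij_betw_byWitness[where f' = "\<lambda>T. T - A"]) (auto simp: card_Diff_subset)
  then have "card ?T = card ?U"
    by (rule bij_betw_same_card[symmetric])
  also have "\<dots> = card (B - A) choose k"
    using assms(1) by (simp add: n_subsets)
  finally show ?thesis
    using assms A by (simp add: card_Diff_subset)
qed

lemma coeff_e2_e1: "coeff (e2_e1_h d p 0) l = (if d \<le> l then int (p choose (l - d)) else 0)"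
proof -
  have "e2_e1_h d p 0 = monom 1 d * [:1, 1:] ^ p"
    by (simp add: e2_e1_h_0 monom_altdef)
  moreover have "coeff ([:1, 1:] ^ p) k = int (p choose k)" for k
    by (cases "k \<le> p") (simp_all add: coeff_linear_poly_power coeff_eq_0 degree_linear_power)
  ultimately show ?thesis
    by (simp add: coeff_monom_mult)
qed

lemma two_column_content_support:
  assumes "two_column_content N \<alpha>"
  shows "{c. \<alpha> c \<noteq> 0} = {c. \<alpha> c = 2} \<union> {c. \<alpha> c = 1}"
proof -
  have "\<alpha> c \<noteq> 0 \<longleftrightarrow> \<alpha> c = 2 \<or> \<alpha> c = 1" for c
    by (rule two_column_content_cases[OF assms, of c]) auto
  then show ?thesis by blast
qed

lemma two_column_content_card:
  assumes "two_column_content N \<alpha>" "finite {c. \<alpha> c \<noteq> 0}"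
  shows "card {c. \<alpha> c \<noteq> 0} = card {c. \<alpha> c = 2} + card {c. \<alpha> c = 1}"
    and "2 * card {c. \<alpha> c = 2} + card {c. \<alpha> c = 1} = N"
proof -
  note support = two_column_content_support[OF assms(1)]
  have fin: "finite {c. \<alpha> c = 2}" "finite {c. \<alpha> c = 1}"
    using assms(2) unfolding support by simp_all
  show "card {c. \<alpha> c \<noteq> 0} = card {c. \<alpha> c = 2} + card {c. \<alpha> c = 1}"
    unfolding support by (rule card_Un_disjoint) (use fin in auto)
  have "N = (\<Sum>c \<in> {c. \<alpha> c = 2} \<union> {c. \<alpha> c = 1}. \<alpha> c)"
    using assms(1) unfolding two_column_content_def support by simp
  also have "\<dots> = (\<Sum>c | \<alpha> c = 2. \<alpha> c) + (\<Sum>c | \<alpha> c = 1. \<alpha> c)"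
    by (rule sum.union_disjoint) (use fin in auto)
  finally show "2 * card {c. \<alpha> c = 2} + card {c. \<alpha> c = 1} = N" by simp
qed

lemma e_coeff_two_column:
  assumes "two_column_content (k + l) \<alpha>" "finite {c. \<alpha> c \<noteq> 0}"
  shows "int (e_coeff [k, l] \<alpha>) = coeff (e2_e1_h (card {c. \<alpha> c = 2}) (card {c. \<alpha> c = 1}) 0) l"
proof (cases "card {c. \<alpha> c = 2} \<le> l")
  case True
  have "{c. \<alpha> c = 2} \<subseteq> {c. \<alpha> c \<noteq> 0}" by auto
  from card_subsets_between[OF assms(2) this, of "l - card {c. \<alpha> c = 2}"] show ?thesis
    unfolding e_coeff_eq_card_subsets[OF assms] two_column_content_card(1)[OF assms] coeff_e2_e1
    using True by simp
next
  case False
  have "card {c. \<alpha> c = 2} \<le> card T" if "{c. \<alpha> c = 2} \<subseteq> T" "T \<subseteq> {c. \<alpha> c \<noteq> 0}" for T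
    using that assms(2) by (intro card_mono) (auto intro: finite_subset)
  then have "{T. {c. \<alpha> c = 2} \<subseteq> T \<and> T \<subseteq> {c. \<alpha> c \<noteq> 0} \<and> card T = l} = {}"
    using False by blast
  then show ?thesis
    unfolding e_coeff_eq_card_subsets[OF assms] coeff_e2_e1
    using False by (simp only: card.empty) simp
qed

section \<open>Weights of words over an interval order of height two\<close>

locale height_two_interval_order =
  fixes V :: "'a::linorder set" and prec :: "'a \<Rightarrow> 'a \<Rightarrow> bool" (infix "\<prec>" 50)
  assumes finite_V [simp]: "finite V"
    and precD: "x \<prec> y \<Longrightarrow> x \<in> V \<and> y \<in> V \<and> x < y"
    and not_prec_chain: "x \<prec> y \<Longrightarrow> \<not> y \<prec> z"
    and incomparable_between: "a \<prec> b \<Longrightarrow> x \<in> V \<Longrightarrow> \<not> x \<prec> b \<Longrightarrow> \<not> a \<prec> x \<Longrightarrow> a < x \<and> x < b"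
begin

definition inc :: "'a \<Rightarrow> 'a \<Rightarrow> bool" where
  "inc x y \<longleftrightarrow> x \<in> V \<and> y \<in> V \<and> x < y \<and> \<not> x \<prec> y"

lemma prec_not_inc: "x \<prec> y \<Longrightarrow> \<not> inc x y" "x \<prec> y \<Longrightarrow> \<not> inc y x"
  using precD[of x y] by (auto simp: inc_def)

abbreviation inv_word :: "'a list \<Rightarrow> nat" where
  "inv_word \<equiv> inversions inc"

definition weight :: "'a list set \<Rightarrow> int poly" where
  "weight L = (\<Sum>xs \<in> L \<inter> permutations_of_set V. monom 1 (inv_word xs))"

lemma weight_empty [simp]: "weight {} = 0"
  by (simp add: weight_def)

lemma weight_Un:
  assumes "A \<inter> B = {}"
  shows "weight (A \<union> B) = weight A + weight B"
  unfolding weight_def Int_Un_distrib2 by (rule sum.union_disjoint) (use assms in auto)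

lemma weight_eq_0:
  assumes "\<And>xs. xs \<in> L \<Longrightarrow> length xs \<noteq> card V"
  shows "weight L = 0"
proof -
  have "L \<inter> permutations_of_set V = {}"
    using assms length_finite_permutations_of_set by blast
  then show ?thesis by (simp add: weight_def)
qed

lemma weight_conc3:
  assumes "\<forall>xs\<in>A. length xs = p" "\<forall>ys\<in>M. length ys = q"
  shows "weight (A \<odot> M \<odot> B) =
    (\<Sum>(x, y, z) \<in> {(x, y, z). x \<in> A \<and> y \<in> M \<and> z \<in> B \<and> x @ y @ z \<in> permutations_of_set V}.
      monom 1 (inv_word (x @ y @ z)))" (is "_ = sum _ ?S")
proof -
  let ?cat = "\<lambda>(x, y, z). x @ y @ z"
  have "A \<odot> M \<odot> B \<inter> permutations_of_set V = ?cat ` ?S"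
    by (force simp: conc_def)
  moreover have "inj_on ?cat ?S"
    using assms by (auto simp: inj_on_def)
  ultimately show ?thesis
    unfolding weight_def by (simp add: sum.reindex case_prod_unfold)
qed

lemma weight_conc_cong:
  assumes A: "\<forall>xs\<in>A. length xs = p" and M: "\<forall>ys\<in>M. length ys = q" and N: "\<forall>ys\<in>N. length ys = q"
    and \<phi>: "\<And>y. y \<in> M \<Longrightarrow> distinct y \<Longrightarrow> set y \<subseteq> V \<Longrightarrow>
      \<phi> y \<in> N \<and> \<psi> (\<phi> y) = y \<and> mset (\<phi> y) = mset y \<and> inv_word (\<phi> y) = inv_word y"
    and \<psi>: "\<And>y. y \<in> N \<Longrightarrow> distinct y \<Longrightarrow> set y \<subseteq> V \<Longrightarrow>
      \<psi> y \<in> M \<and> \<phi> (\<psi> y) = y \<and> mset (\<psi> y) = mset y"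
  shows "weight (A \<odot> M \<odot> B) = weight (A \<odot> N \<odot> B)"
proof -
  have perm: "x @ y' @ z \<in> permutations_of_set V"
    if "x @ y @ z \<in> permutations_of_set V" "mset y' = mset y" for x y y' z
    using that mset_eq_imp_distinct_iff[OF that(2)] mset_eq_setD[OF that(2)]
    by (simp add: permutations_of_set_def)
  have factor: "distinct y \<and> set y \<subseteq> V" if "x @ y @ z \<in> permutations_of_set V" for x y z
    using that by (auto simp: permutations_of_set_def)
  show ?thesis
    unfolding weight_conc3[OF A M] weight_conc3[OF A N]
    by (rule sum.reindex_bij_witness
          [where i = "\<lambda>(x, y, z). (x, \<psi> y, z)" and j = "\<lambda>(x, y, z). (x, \<phi> y, z)"])
       (use \<phi> \<psi> factor perm in \<open>auto intro!: arg_cong[where f = "monom 1"] inversions_infix_cong\<close>)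
qed

section \<open>Symmetry\<close>

definition chain_words :: "nat \<Rightarrow> 'a list set" where
  "chain_words k = {xs. length xs = k \<and> sorted_wrt (\<lambda>x y. y \<prec> x) xs}"

lemma chain_words_0 [simp]: "chain_words 0 = {[]}"
  and chain_words_1: "chain_words (Suc 0) = {[x] | x. True}"
  and chain_words_2: "chain_words 2 = {[b, a] | a b. a \<prec> b}"
  by (auto simp: chain_words_def length_Suc_conv numeral_2_eq_2)

lemma chain_words_1_conc: "chain_words (Suc 0) \<odot> B = {x # w | x w. w \<in> B}"
  using append_in_conc[of "[_]" "chain_words (Suc 0)" _ B] by (auto simp: conc_def chain_words_1)

lemma chain_words_2_conc: "chain_words 2 \<odot> B = {b # a # w | a b w. a \<prec> b \<and> w \<in> B}"
  using append_in_conc[of "[_, _]" "chain_words 2" _ B] by (auto simp: conc_def chain_words_2)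

lemma chain_words_ge_3: "k \<ge> 3 \<Longrightarrow> chain_words k = {}"
  using not_prec_chain by (auto simp: chain_words_def numeral_3_eq_3 Suc_le_length_iff)

lemma length_conc_list_chain_words: "\<forall>xs\<in>conc_list (map chain_words u). length xs = sum_list u"
  by (induction u) (auto simp: conc_def chain_words_def)

text \<open>If \<open>a \<prec> b\<close> is the only relation in the triple, then \<open>a < x < b\<close>, so moving \<open>x\<close> across
  both trades one inversion for another.\<close>

definition pair_right :: "'a list \<Rightarrow> 'a list" where
  "pair_right ys = (case ys of [b, a, x] \<Rightarrow>
     if x \<prec> b then [a, b, x] else if a \<prec> x then [b, x, a] else [x, b, a] | _ \<Rightarrow> ys)"

definition pair_left :: "'a list \<Rightarrow> 'a list" where
  "pair_left ys = (case ys of [x, b, a] \<Rightarrow>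
     if a \<prec> x then [x, a, b] else if x \<prec> b then [b, x, a] else [b, a, x] | _ \<Rightarrow> ys)"

lemma chain_words_2_1: "chain_words 2 \<odot> chain_words (Suc 0) = {[b, a, x] | a b x. a \<prec> b}"
  and chain_words_1_2: "chain_words (Suc 0) \<odot> chain_words 2 = {[x, b, a] | a b x. a \<prec> b}"
  by (auto simp: chain_words_2_conc chain_words_1_conc) (auto simp: chain_words_1 chain_words_2)

lemma pair_right_exchange:
  assumes "y \<in> chain_words 2 \<odot> chain_words (Suc 0)" "set y \<subseteq> V"
  shows "pair_right y \<in> chain_words (Suc 0) \<odot> chain_words 2 \<and> pair_left (pair_right y) = y \<and>
    mset (pair_right y) = mset y \<and> inv_word (pair_right y) = inv_word y"
proof -
  obtain a b x where y: "y = [b, a, x]" "a \<prec> b"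
    using assms(1) by (auto simp: chain_words_2_1)
  consider "x \<prec> b" | "\<not> x \<prec> b" "a \<prec> x" | "\<not> x \<prec> b" "\<not> a \<prec> x" by blast
  then show ?thesis
  proof cases
    case 1
    then show ?thesis
      using y not_prec_chain[of x a b] prec_not_inc[of a b]
      by (auto simp: pair_right_def pair_left_def chain_words_1_2)
  next
    case 2
    then show ?thesis
      using y prec_not_inc[of a x] by (auto simp: pair_right_def pair_left_def chain_words_1_2)
  next
    case 3
    then have "a < x" "x < b"
      using incomparable_between[of a b x] y assms(2) by auto
    then have "inc a x" "inc x b" "\<not> inc x a" "\<not> inc b x"
      using y assms(2) 3 by (auto simp: inc_def)
    then show ?thesis
      using 3 y by (auto simp: pair_right_def pair_left_def chain_words_1_2)
  qed
qed

lemma pair_left_exchange: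
  assumes "y \<in> chain_words (Suc 0) \<odot> chain_words 2"
  shows "pair_left y \<in> chain_words 2 \<odot> chain_words (Suc 0) \<and> pair_right (pair_left y) = y \<and>
    mset (pair_left y) = mset y"
proof -
  obtain a b x where y: "y = [x, b, a]" "a \<prec> b"
    using assms by (auto simp: chain_words_1_2)
  then show ?thesis
    using not_prec_chain[OF y(2), of x] by (auto simp: pair_right_def pair_left_def chain_words_2_1)
qed

lemma weight_swap_pair_singleton:
  assumes "\<forall>xs\<in>A. length xs = p"
  shows "weight (A \<odot> (chain_words 2 \<odot> chain_words (Suc 0)) \<odot> B) =
    weight (A \<odot> (chain_words (Suc 0) \<odot> chain_words 2) \<odot> B)"
  by (rule weight_conc_cong[OF assms, where q = 3 and \<phi> = pair_right and \<psi> = pair_left])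
     (use pair_right_exchange pair_left_exchange in \<open>auto simp: chain_words_2_1 chain_words_1_2\<close>)

lemma weight_swap_chains:
  assumes "\<forall>xs\<in>A. length xs = p"
  shows "weight (A \<odot> (chain_words j \<odot> chain_words k) \<odot> B) =
    weight (A \<odot> (chain_words k \<odot> chain_words j) \<odot> B)"
proof -
  consider "j = k" | "j = 0 \<or> k = 0" | "j \<ge> 3 \<or> k \<ge> 3" | "j = 2" "k = 1" | "j = 1" "k = 2"
    by linarith
  then show ?thesis
    by cases (auto simp: chain_words_ge_3 weight_swap_pair_singleton[OF assms])
qed

definition descent_free :: "nat \<Rightarrow> 'a list set" where
  "descent_free q = {xs. length xs = q \<and> successively (\<lambda>x y. \<not> y \<prec> x) xs}"

lemma length_descent_free: "\<forall>xs\<in>descent_free q. length xs = q"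
  by (simp add: descent_free_def)

lemma descent_free_0 [simp]: "descent_free 0 = {[]}"
  and descent_free_1: "descent_free (Suc 0) = chain_words (Suc 0)"
  by (auto simp: descent_free_def chain_words_1 length_Suc_conv)

definition block_weight :: "nat list \<Rightarrow> nat \<Rightarrow> int poly" where
  "block_weight u q = weight (conc_list (map chain_words u) \<odot> descent_free q)"

lemma block_weight_mset_cong:
  assumes "mset u = mset v"
  shows "block_weight u q = block_weight v q"
proof (rule eq_if_adjacent_swap_invariant[OF _ assms])
  fix u j k v
  show "block_weight (u @ j # k # v) q = block_weight (u @ k # j # v) q"
    using weight_swap_chains[OF length_conc_list_chain_words, of u j k
        "conc_list (map chain_words v) \<odot> descent_free q"]
    by (simp add: block_weight_def conc_assoc)
qed

lemma block_weight_eq_0: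
  assumes "sum_list u + q \<noteq> card V"
  shows "block_weight u q = 0"
  unfolding block_weight_def
  by (rule weight_eq_0)
     (use assms length_conc_list_chain_words[of u] length_descent_free in \<open>auto simp: conc_def\<close>)

section \<open>The recursion for descent-free words\<close>

lemma singleton_conc_descent_free:
  "chain_words (Suc 0) \<odot> descent_free (Suc q) =
     descent_free (Suc (Suc q)) \<union> chain_words 2 \<odot> descent_free q"
  and descent_free_disjoint: "descent_free (Suc (Suc q)) \<inter> (chain_words 2 \<odot> descent_free q) = {}"
proof -
  let ?P = "\<lambda>x y. \<not> y \<prec> x"
  have singleton: "chain_words (Suc 0) \<odot> descent_free (Suc q) =
      {x # y # zs | x y zs. successively ?P (y # zs) \<and> length zs = q}"
    by (auto simp: chain_words_1_conc descent_free_def length_Suc_conv)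
  have pair: "chain_words 2 \<odot> descent_free q =
      {x # y # zs | x y zs. y \<prec> x \<and> successively ?P zs \<and> length zs = q}"
    by (auto simp: chain_words_2_conc descent_free_def)
  have free: "descent_free (Suc (Suc q)) =
      {x # y # zs | x y zs. \<not> y \<prec> x \<and> successively ?P (y # zs) \<and> length zs = q}"
    by (auto simp: descent_free_def length_Suc_conv)
  have "successively ?P (y # zs) \<longleftrightarrow> successively ?P zs" if "y \<prec> x" for x y zs
    using not_prec_chain that by (cases zs) auto
  then show "chain_words (Suc 0) \<odot> descent_free (Suc q) =
      descent_free (Suc (Suc q)) \<union> chain_words 2 \<odot> descent_free q"
    unfolding singleton pair free by blast
  show "descent_free (Suc (Suc q)) \<inter> (chain_words 2 \<odot> descent_free q) = {}"
    unfolding pair free by blast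
qed

lemma block_weight_snoc_1_0: "block_weight (u @ [Suc 0]) 0 = block_weight u (Suc 0)"
  using descent_free_1 by (simp add: block_weight_def conc_assoc)

lemma block_weight_snoc_1_Suc:
  "block_weight (u @ [Suc 0]) (Suc q) = block_weight u (Suc (Suc q)) + block_weight (u @ [2]) q"
proof -
  let ?A = "conc_list (map chain_words u)"
  have "?A \<odot> chain_words (Suc 0) \<odot> descent_free (Suc q) =
      ?A \<odot> descent_free (Suc (Suc q)) \<union> ?A \<odot> chain_words 2 \<odot> descent_free q"
    by (simp add: singleton_conc_descent_free conc_Un)
  moreover have "(?A \<odot> descent_free (Suc (Suc q))) \<inter> (?A \<odot> chain_words 2 \<odot> descent_free q) = {}"
    by (rule conc_disjoint[OF length_conc_list_chain_words descent_free_disjoint])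
  ultimately show ?thesis
    by (simp add: block_weight_def conc_assoc weight_Un)
qed

section \<open>Dominated words\<close>

definition dominated :: "'a list \<Rightarrow> bool" where
  "dominated w \<longleftrightarrow> (\<exists>s. 1 \<le> s \<and> s < length w \<and> (\<forall>i<s. w ! i \<prec> w ! s))"

lemma dominated_iff_append:
  "dominated w \<longleftrightarrow> (\<exists>u b v. w = u @ b # v \<and> u \<noteq> [] \<and> (\<forall>x\<in>set u. x \<prec> b))"
proof
  assume "dominated w"
  then obtain s where "1 \<le> s" "s < length w" "\<forall>i<s. w ! i \<prec> w ! s"
    unfolding dominated_def by blast
  then show "\<exists>u b v. w = u @ b # v \<and> u \<noteq> [] \<and> (\<forall>x\<in>set u. x \<prec> b)"
    by (intro exI[of _ "take s w"] exI[of _ "w ! s"] exI[of _ "drop (Suc s) w"])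
       (auto simp: id_take_nth_drop[symmetric] in_set_conv_nth)
next
  assume "\<exists>u b v. w = u @ b # v \<and> u \<noteq> [] \<and> (\<forall>x\<in>set u. x \<prec> b)"
  then obtain u b v where "w = u @ b # v" "u \<noteq> []" "\<forall>x\<in>set u. x \<prec> b" by blast
  then show "dominated w"
    unfolding dominated_def
    by (intro exI[of _ "length u"]) (auto simp: nth_append Suc_le_eq)
qed

definition dominating_split :: "'a list \<Rightarrow> 'a \<Rightarrow> 'a list \<Rightarrow> bool" where
  "dominating_split u b v \<longleftrightarrow> u \<noteq> [] \<and> (\<forall>x\<in>set u. x \<prec> b) \<and>
     successively (\<lambda>x y. \<not> y \<prec> x) v \<and> (v = [] \<or> \<not> hd v \<prec> b)"

lemma successively_append_below:
  assumes "\<forall>x\<in>set u. x \<prec> b"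
  shows "successively (\<lambda>x y. \<not> y \<prec> x) (u @ w) \<longleftrightarrow> successively (\<lambda>x y. \<not> y \<prec> x) w"
  using assms not_prec_chain by (induction u) (auto simp: successively_Cons)

lemma dominated_descent_free:
  "{w \<in> descent_free (Suc q). dominated w} =
    {u @ b # v | u b v. dominating_split u b v \<and> length u + length v = q}"
proof (intro equalityI subsetI)
  fix w assume w: "w \<in> {w \<in> descent_free (Suc q). dominated w}"
  then obtain u b v where split: "w = u @ b # v" "u \<noteq> []" "\<forall>x\<in>set u. x \<prec> b"
    using dominated_iff_append by auto
  moreover have "dominating_split u b v" and "length u + length v = q"
    using w split successively_append_below[OF split(3), of "b # v"]
    by (auto simp: descent_free_def dominating_split_def successively_Cons)
  ultimately show "w \<in> {u @ b # v | u b v. dominating_split u b v \<and> length u + length v = q}"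
    by blast
next
  fix w assume "w \<in> {u @ b # v | u b v. dominating_split u b v \<and> length u + length v = q}"
  then obtain u b v where "w = u @ b # v" "dominating_split u b v" "length u + length v = q"
    by blast
  then show "w \<in> {w \<in> descent_free (Suc q). dominated w}"
    using successively_append_below[of u b "b # v"]
    by (auto simp: descent_free_def dominating_split_def successively_Cons dominated_iff_append)
qed

lemma pair_conc_descent_free:
  "chain_words 2 \<odot> descent_free q =
    {b # u @ v | u b v. dominating_split u b v \<and> length u + length v = Suc q}"
proof (intro equalityI subsetI)
  fix w assume "w \<in> chain_words 2 \<odot> descent_free q"
  then obtain a b y where w: "w = b # a # y" "a \<prec> b" and y: "y \<in> descent_free q"
    by (auto simp: chain_words_2_conc)
  let ?u = "takeWhile (\<lambda>x. x \<prec> b) y" and ?v = "dropWhile (\<lambda>x. x \<prec> b) y"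
  have below: "\<forall>x\<in>set ?u. x \<prec> b"
    by (auto dest: set_takeWhileD)
  have "successively (\<lambda>x y. \<not> y \<prec> x) ?v"
    using y successively_append_below[OF below, of ?v] by (simp add: descent_free_def)
  then have "dominating_split (a # ?u) b ?v"
    using w(2) below hd_dropWhile[of "\<lambda>x. x \<prec> b" y] by (auto simp: dominating_split_def)
  moreover have "w = b # (a # ?u) @ ?v" and "length (a # ?u) + length ?v = Suc q"
    using w y by (auto simp: descent_free_def length_append[symmetric] simp del: length_append)
  ultimately show "w \<in> {b # u @ v | u b v. dominating_split u b v \<and> length u + length v = Suc q}"
    by blast
next
  fix w assume "w \<in> {b # u @ v | u b v. dominating_split u b v \<and> length u + length v = Suc q}"
  then obtain u b v where w: "w = b # u @ v" "dominating_split u b v" "length u + length v = Suc q"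
    by blast
  then obtain a u' where u: "u = a # u'" "\<forall>x\<in>set u'. x \<prec> b"
    by (cases u) (auto simp: dominating_split_def)
  then show "w \<in> chain_words 2 \<odot> descent_free q"
    using w successively_append_below[OF u(2), of v]
    by (auto simp: chain_words_2_conc descent_free_def dominating_split_def)
qed

definition raise :: "'a list \<Rightarrow> 'a list" where
  "raise w = (case dropWhile (\<lambda>x. \<not> hd w \<prec> x) w of
     b # v \<Rightarrow> b # takeWhile (\<lambda>x. \<not> hd w \<prec> x) w @ v | [] \<Rightarrow> w)"

definition lower :: "'a list \<Rightarrow> 'a list" where
  "lower w = takeWhile (\<lambda>x. x \<prec> hd w) (tl w) @ hd w # dropWhile (\<lambda>x. x \<prec> hd w) (tl w)"

lemma raise_append:
  assumes "dominating_split u b v"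
  shows "raise (u @ b # v) = b # u @ v"
proof -
  obtain a u' where u: "u = a # u'" "a \<prec> b" "\<forall>x\<in>set u. x \<prec> b"
    using assms by (cases u) (auto simp: dominating_split_def)
  then have "\<forall>x\<in>set u. \<not> a \<prec> x"
    using not_prec_chain by blast
  then have "takeWhile (\<lambda>x. \<not> a \<prec> x) (u @ b # v) = u" "dropWhile (\<lambda>x. \<not> a \<prec> x) (u @ b # v) = b # v"
    using u(2) by auto
  then show ?thesis
    using u(1) by (simp add: raise_def)
qed

lemma lower_Cons:
  assumes "dominating_split u b v"
  shows "lower (b # u @ v) = u @ b # v"
  using assms by (cases v) (auto simp: lower_def dominating_split_def)

lemma inv_word_move_dominating:
  assumes "\<forall>x\<in>set u. x \<prec> b"
  shows "inv_word (u @ b # v) = inv_word (b # u @ v)"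
proof -
  have "(\<Sum>x\<leftarrow>u. length (filter (\<lambda>y. inc y x) [b])) = 0"
    using assms prec_not_inc by (induction u) auto
  moreover have "filter (\<lambda>y. inc y b) u = []"
    using assms prec_not_inc by (auto simp: filter_empty_conv)
  ultimately have "inv_word (u @ [b]) = inv_word (b # u)"
    by (simp add: inversions_append)
  then show ?thesis
    using inversions_infix_cong[of "u @ [b]" "b # u" _ "[]" v] by simp
qed

lemma weight_dominated:
  assumes "\<forall>xs\<in>A. length xs = p"
  shows "weight (A \<odot> {w \<in> descent_free (Suc (Suc q)). dominated w}) =
    weight (A \<odot> chain_words 2 \<odot> descent_free q)"
proof -
  let ?D = "{w \<in> descent_free (Suc (Suc q)). dominated w}" and ?P = "chain_words 2 \<odot> descent_free q"
  have "weight (A \<odot> ?D \<odot> {[]}) = weight (A \<odot> ?P \<odot> {[]})"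
  proof (rule weight_conc_cong[where \<phi> = raise and \<psi> = lower and q = "Suc (Suc q)", OF assms])
    fix w assume "w \<in> ?D"
    then obtain u b v
      where w: "w = u @ b # v" "dominating_split u b v" "length u + length v = Suc q"
      unfolding dominated_descent_free by blast
    then have "inv_word (b # u @ v) = inv_word w"
      using inv_word_move_dominating[of u b v] by (simp add: dominating_split_def)
    moreover have "b # u @ v \<in> ?P"
      unfolding pair_conc_descent_free using w by blast
    ultimately show "raise w \<in> ?P \<and> lower (raise w) = w \<and> mset (raise w) = mset w \<and>
        inv_word (raise w) = inv_word w"
      using w by (simp add: raise_append lower_Cons)
  next
    fix w assume "w \<in> ?P"
    then obtain u b v
      where w: "w = b # u @ v" "dominating_split u b v" "length u + length v = Suc q"
      unfolding pair_conc_descent_free by blast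
    moreover from this have "u @ b # v \<in> ?D"
      unfolding dominated_descent_free by blast
    ultimately show "lower w \<in> ?D \<and> raise (lower w) = w \<and> mset (lower w) = mset w"
      by (simp add: raise_append lower_Cons)
  qed (auto simp: descent_free_def chain_words_2_conc)
  then show ?thesis by simp
qed

definition pair_words :: "nat \<Rightarrow> 'a list set" where
  "pair_words l = conc_list (replicate l (chain_words 2))"

definition bar_words :: "nat \<Rightarrow> 'a list set" where
  "bar_words l = pair_words l \<odot> {w \<in> descent_free (card V - 2 * l). \<not> dominated w}"

definition bar_weight :: "nat \<Rightarrow> int poly" where
  "bar_weight l = weight (bar_words l)"

lemma length_pair_words: "\<forall>xs\<in>pair_words l. length xs = 2 * l"
  using length_conc_list_chain_words[of "replicate l 2"]
  by (simp add: pair_words_def sum_list_replicate)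

lemma pair_words_Suc: "pair_words (Suc l) = pair_words l \<odot> chain_words 2"
  unfolding pair_words_def replicate_Suc replicate_append_same[symmetric] by simp

lemma block_weight_pairs: "block_weight (replicate l 2) q = weight (pair_words l \<odot> descent_free q)"
  by (simp add: block_weight_def pair_words_def)

lemma block_weight_pairs_step:
  assumes "2 * l \<le> card V"
  shows "block_weight (replicate l 2) (card V - 2 * l) =
    bar_weight l + block_weight (replicate (Suc l) 2) (card V - 2 * Suc l)"
proof -
  let ?q = "card V - 2 * l"
  let ?D = "{w \<in> descent_free ?q. dominated w}" and ?U = "{w \<in> descent_free ?q. \<not> dominated w}"
  have "descent_free ?q = ?U \<union> ?D"
    by blast
  then have "pair_words l \<odot> descent_free ?q = bar_words l \<union> pair_words l \<odot> ?D"
    unfolding bar_words_def by (metis conc_Un)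
  moreover have "bar_words l \<inter> (pair_words l \<odot> ?D) = {}"
    unfolding bar_words_def by (rule conc_disjoint[OF length_pair_words]) blast
  ultimately have "block_weight (replicate l 2) ?q = bar_weight l + weight (pair_words l \<odot> ?D)"
    by (simp add: block_weight_pairs bar_weight_def weight_Un)
  also have "weight (pair_words l \<odot> ?D) = block_weight (replicate (Suc l) 2) (card V - 2 * Suc l)"
  proof (cases "2 * Suc l \<le> card V")
    case True
    then have "?q = Suc (Suc (card V - 2 * Suc l))" by simp
    then show ?thesis
      using weight_dominated[OF length_pair_words, of l "card V - 2 * Suc l"]
      unfolding block_weight_pairs pair_words_Suc by (simp add: conc_assoc)
  next
    case False
    then have "?D = {}"
      by (auto simp: descent_free_def dominated_def)
    moreover have "block_weight (replicate (Suc l) 2) (card V - 2 * Suc l) = 0"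
      using False by (intro block_weight_eq_0) (simp add: sum_list_replicate)
    ultimately show ?thesis by (simp only: conc_empty weight_empty)
  qed
  finally show ?thesis .
qed

lemma block_weight_pairs_eq_sum:
  assumes "2 * d \<le> card V"
  shows "block_weight (replicate d 2) (card V - 2 * d) = (\<Sum>l = d..card V div 2. bar_weight l)"
proof -
  have zero: "block_weight (replicate (Suc (card V div 2)) 2) (card V - 2 * Suc (card V div 2)) = 0"
    by (intro block_weight_eq_0) (simp add: sum_list_replicate del: replicate.simps)
  have "d \<le> card V div 2" using assms by simp
  then show ?thesis
  proof (induction rule: inc_induct)
    case base
    then show ?case using zero block_weight_pairs_step[of "card V div 2"] by simp
  next
    case (step k)
    then show ?case using block_weight_pairs_step[of k] by (simp add: sum.atLeast_Suc_atMost)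
  qed
qed

section \<open>Expansion of block weights\<close>

lemma block_weight_expansion:
  assumes "2 * d + p + q = card V"
  shows "block_weight (replicate d 2 @ replicate p 1) q =
    (\<Sum>l = 0..card V div 2. smult (coeff (e2_e1_h d p q) l) (bar_weight l))"
  using assms
proof (induction p arbitrary: d q)
  case 0
  then have "q = card V - 2 * d" "2 * d \<le> card V" by simp_all
  then have "block_weight (replicate d 2) q = (\<Sum>l = d..card V div 2. bar_weight l)"
    using block_weight_pairs_eq_sum by simp
  also have "\<dots> = (\<Sum>l = 0..card V div 2. smult (coeff (e2_e1_h d 0 q) l) (bar_weight l))"
    by (rule sum.mono_neutral_cong_left) (use 0 in \<open>auto simp: coeff_e2_h\<close>)
  finally show ?case by simp
next
  case (Suc p)
  let ?u = "replicate d 2 @ replicate p 1"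
  have snoc: "replicate d 2 @ replicate (Suc p) (Suc 0) = ?u @ [Suc 0]"
    by (simp add: replicate_append_same)
  show ?case
  proof (cases q)
    case 0
    then show ?thesis
      using Suc.IH[of d "Suc 0"] Suc.prems block_weight_snoc_1_0[of ?u]
      by (simp add: snoc e2_e1_h_Suc_0 del: replicate.simps)
  next
    case q: (Suc q')
    have "block_weight (?u @ [2]) q' = block_weight (replicate (Suc d) 2 @ replicate p 1) q'"
      by (rule block_weight_mset_cong) simp
    then have "block_weight (?u @ [1]) (Suc q') =
        block_weight ?u (Suc (Suc q')) + block_weight (replicate (Suc d) 2 @ replicate p 1) q'"
      using block_weight_snoc_1_Suc[of ?u q'] by simp
    then show ?thesis
      using Suc.IH[of d "Suc (Suc q')"] Suc.IH[of "Suc d" q'] Suc.prems q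
      by (simp add: snoc e2_e1_h_Suc_Suc smult_add_left sum.distrib del: replicate.simps)
  qed
qed

end

section \<open>Colorings as words\<close>

lemma sorted_wrt_greater_conv:
  fixes xs :: "'a::order list"
  assumes "sorted_wrt (\<lambda>x y. y < x) xs"
  shows "sorted_wrt R xs \<longleftrightarrow> (\<forall>x\<in>set xs. \<forall>y\<in>set xs. y < x \<longrightarrow> R x y)"
  using assms by (induction xs) (auto dest: less_asym)

lemma disjoint_cover_coloring:
  assumes "disjoint_family_on A C" "(\<Union>c\<in>C. A c) = V"
  shows "\<exists>\<kappa> \<in> V \<rightarrow>\<^sub>E C. \<forall>c\<in>C. {v \<in> V. \<kappa> v = c} = A c"
proof -
  have "\<forall>v\<in>V. \<exists>c\<in>C. v \<in> A c"
    using assms(2) by blast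
  then obtain f where f: "\<And>v. v \<in> V \<Longrightarrow> f v \<in> C \<and> v \<in> A (f v)"
    by metis
  have "{v \<in> V. restrict f V v = c} = A c" if "c \<in> C" for c
  proof (intro equalityI subsetI)
    fix v assume v: "v \<in> A c"
    then have "v \<in> V" using assms(2) that by blast
    then show "v \<in> {v \<in> V. restrict f V v = c}"
      using f[of v] v that disjoint_family_onD[OF assms(1), of "f v" c] by auto
  qed (use f in auto)
  then show ?thesis
    using f by (intro bexI[of _ "restrict f V"]) auto
qed

lemma disjoint_family_on_if_distinct_concat:
  assumes "distinct (concat (map \<rho> cs))" "distinct cs"
  shows "disjoint_family_on (\<lambda>c. set (\<rho> c)) (set cs)"
  using assms by (induction cs) (auto simp: disjoint_family_on_def)

locale height_two_interval_order_nat = height_two_interval_order V prec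
  for V :: "nat set" and prec :: "nat \<Rightarrow> nat \<Rightarrow> bool" (infix "\<prec>" 50)
begin

definition color_row :: "(nat \<Rightarrow> nat) \<Rightarrow> nat \<Rightarrow> nat list" where
  "color_row \<kappa> c = rev (sorted_list_of_set {v \<in> V. \<kappa> v = c})"

definition color_word :: "nat list \<Rightarrow> (nat \<Rightarrow> nat) \<Rightarrow> nat list" where
  "color_word cs \<kappa> = concat (map (color_row \<kappa>) cs)"

definition color_order :: "(nat \<Rightarrow> nat) \<Rightarrow> nat \<Rightarrow> nat \<Rightarrow> bool" where
  "color_order \<kappa> x y \<longleftrightarrow> \<kappa> y < \<kappa> x \<or> (\<kappa> x = \<kappa> y \<and> y < x)"

lemma asymp_color_order: "asymp (color_order \<kappa>)"
  by (rule asympI) (auto simp: color_order_def)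

lemma set_color_row [simp]: "set (color_row \<kappa> c) = {v \<in> V. \<kappa> v = c}"
  and length_color_row [simp]: "length (color_row \<kappa> c) = card {v \<in> V. \<kappa> v = c}"
  and sorted_color_row: "sorted_wrt (\<lambda>x y. y < x) (color_row \<kappa> c)"
  by (simp_all add: color_row_def sorted_wrt_rev)

lemma color_row_in_chain_words_iff:
  "color_row \<kappa> c \<in> chain_words k \<longleftrightarrow>
    card {v \<in> V. \<kappa> v = c} = k \<and> (\<forall>i j. inc i j \<longrightarrow> \<not> (\<kappa> i = c \<and> \<kappa> j = c))"
  unfolding chain_words_def mem_Collect_eq length_color_row set_color_row inc_def
    sorted_wrt_greater_conv[OF sorted_color_row] by blast

lemma colorings_with_content_iff:
  "\<kappa> \<in> colorings_with_content V inc \<alpha> \<longleftrightarrow>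
    \<kappa> \<in> V \<rightarrow>\<^sub>E {1..} \<and> (\<forall>c. color_row \<kappa> c \<in> chain_words (\<alpha> c))"
  unfolding colorings_with_content_def proper_coloring_def mem_Collect_eq
    color_row_in_chain_words_iff
  by metis

lemma color_row_eqI:
  assumes "ys \<in> chain_words k" "{v \<in> V. \<kappa> v = c} = set ys"
  shows "color_row \<kappa> c = ys"
proof -
  have "sorted_wrt (\<lambda>x y. y < x) ys"
    by (rule sorted_wrt_mono_rel[where P = "\<lambda>x y. y \<prec> x"])
       (use assms(1) precD in \<open>auto simp: chain_words_def\<close>)
  then have "sorted_wrt (<) (rev ys)" by (simp add: sorted_wrt_rev)
  then have "sorted_list_of_set (set (rev ys)) = rev ys"
    by (intro sorted_list_of_set.idem_if_sorted_distinct) (auto simp: strict_sorted_iff)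
  then show ?thesis unfolding color_row_def assms(2) by simp
qed

lemma sorted_color_word:
  assumes "sorted_wrt (\<lambda>x y. y < x) cs"
  shows "sorted_wrt (color_order \<kappa>) (color_word cs \<kappa>)"
  using assms
proof (induction cs)
  case Nil
  then show ?case by (simp add: color_word_def)
next
  case (Cons c cs)
  have "sorted_wrt (color_order \<kappa>) (color_row \<kappa> c)"
    by (simp add: sorted_wrt_greater_conv[OF sorted_color_row] color_order_def)
  moreover have "color_order \<kappa> x y" if "x \<in> set (color_row \<kappa> c)" "y \<in> set (color_word cs \<kappa>)" for x y
    using that Cons.prems by (auto simp: color_word_def color_order_def)
  ultimately show ?case
    using Cons by (simp add: color_word_def sorted_wrt_append del: set_color_row)
qed

lemma inv_word_color_word:
  assumes \<kappa>: "\<kappa> \<in> colorings_with_content V inc \<alpha>" and cs: "sorted_wrt (\<lambda>x y. y < x) cs"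
    and set: "set (color_word cs \<kappa>) = V"
  shows "inv_word (color_word cs \<kappa>) = asc inc \<kappa>"
proof -
  have "inv_word (color_word cs \<kappa>) = card {(i, j). i \<in> V \<and> j \<in> V \<and> color_order \<kappa> j i \<and> inc i j}"
    using inversions_map_sorted_wrt[OF sorted_color_word[OF cs] asymp_color_order, of inc id \<kappa>] set
    by simp
  also have "{(i, j). i \<in> V \<and> j \<in> V \<and> color_order \<kappa> j i \<and> inc i j} = {(i, j). inc i j \<and> \<kappa> i < \<kappa> j}"
  proof -
    have "\<kappa> i \<noteq> \<kappa> j" if "inc i j" for i j
      using \<kappa> that by (auto simp: colorings_with_content_def proper_coloring_def)
    then show ?thesis
      by (fastforce simp: color_order_def inc_def)
  qed
  finally show ?thesis by (simp add: asc_def)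
qed

context
  fixes \<alpha> :: "nat \<Rightarrow> nat" and cs :: "nat list"
  assumes cs: "sorted_wrt (\<lambda>x y. y < x) cs" and support: "{c. \<alpha> c \<noteq> 0} = set cs" and \<alpha>_0: "\<alpha> 0 = 0"
begin

lemma distinct_colors: "distinct cs"
  using cs by (rule distinct_if_sorted_wrt) (auto intro: asympI)

lemma coloring_in_colors:
  assumes "\<kappa> \<in> colorings_with_content V inc \<alpha>" "v \<in> V"
  shows "\<kappa> v \<in> set cs"
proof -
  have "\<alpha> (\<kappa> v) = card {u \<in> V. \<kappa> u = \<kappa> v}"
    using assms(1) by (simp add: colorings_with_content_def)
  also have "\<dots> \<noteq> 0"
    using assms(2) by (subst card_eq_0_iff) auto
  finally show ?thesis using support by auto
qed

lemma color_word_in_conc_list: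
  assumes \<kappa>: "\<kappa> \<in> colorings_with_content V inc \<alpha>"
  shows "color_word cs \<kappa> \<in> conc_list (map (\<lambda>c. chain_words (\<alpha> c)) cs)"
    and "color_word cs \<kappa> \<in> permutations_of_set V"
proof -
  show "color_word cs \<kappa> \<in> conc_list (map (\<lambda>c. chain_words (\<alpha> c)) cs)"
    using \<kappa>
    unfolding conc_list_map_iff[OF distinct_colors] color_word_def colorings_with_content_iff
    by blast
  have "distinct (color_word cs \<kappa>)"
    using sorted_color_word[OF cs] asymp_color_order by (rule distinct_if_sorted_wrt)
  moreover have "set (color_word cs \<kappa>) = V"
    using coloring_in_colors[OF \<kappa>] by (auto simp: color_word_def)
  ultimately show "color_word cs \<kappa> \<in> permutations_of_set V" by blast
qed

lemma inj_on_color_word: "inj_on (color_word cs) (colorings_with_content V inc \<alpha>)"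
proof (rule inj_onI)
  fix \<kappa> \<kappa>' assume \<kappa>: "\<kappa> \<in> colorings_with_content V inc \<alpha>" "\<kappa>' \<in> colorings_with_content V inc \<alpha>"
    and eq: "color_word cs \<kappa> = color_word cs \<kappa>'"
  have "map (color_row \<kappa>) cs = map (color_row \<kappa>') cs"
    using eq \<kappa> unfolding color_word_def
    by (subst (asm) concat_eq_concat_iff)
       (auto simp: zip_map_map zip_same_conv_map colorings_with_content_def)
  then have row: "set (color_row \<kappa> c) = set (color_row \<kappa>' c)" if "c \<in> set cs" for c
    using that by simp
  show "\<kappa> = \<kappa>'"
  proof (rule PiE_ext)
    show "\<kappa> \<in> V \<rightarrow>\<^sub>E {1..}" "\<kappa>' \<in> V \<rightarrow>\<^sub>E {1..}"
      using \<kappa> by (auto simp: colorings_with_content_iff)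
    fix v assume "v \<in> V"
    then have "v \<in> set (color_row \<kappa> (\<kappa> v))" by simp
    also have "\<dots> = set (color_row \<kappa>' (\<kappa> v))"
      using row coloring_in_colors[OF \<kappa>(1) \<open>v \<in> V\<close>] .
    finally show "\<kappa> v = \<kappa>' v" by simp
  qed
qed

lemma word_is_color_word:
  assumes "xs \<in> conc_list (map (\<lambda>c. chain_words (\<alpha> c)) cs)" "xs \<in> permutations_of_set V"
  obtains \<kappa> where "\<kappa> \<in> colorings_with_content V inc \<alpha>" "color_word cs \<kappa> = xs"
proof -
  obtain \<rho> where \<rho>: "\<And>c. c \<in> set cs \<Longrightarrow> \<rho> c \<in> chain_words (\<alpha> c)" "xs = concat (map \<rho> cs)"
    using assms(1) unfolding conc_list_map_iff[OF distinct_colors] by blast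
  have "disjoint_family_on (\<lambda>c. set (\<rho> c)) (set cs)" "(\<Union>c\<in>set cs. set (\<rho> c)) = V"
    using assms(2) disjoint_family_on_if_distinct_concat[OF _ distinct_colors, of \<rho>]
    by (auto simp: permutations_of_set_def \<rho>(2))
  from disjoint_cover_coloring[OF this] obtain \<kappa> where \<kappa>: "\<kappa> \<in> V \<rightarrow>\<^sub>E set cs"
    "\<And>c. c \<in> set cs \<Longrightarrow> {v \<in> V. \<kappa> v = c} = set (\<rho> c)"
    by blast
  have row: "color_row \<kappa> c = \<rho> c" if "c \<in> set cs" for c
    using color_row_eqI \<rho>(1)[OF that] \<kappa>(2)[OF that] by blast
  have "color_row \<kappa> c \<in> chain_words (\<alpha> c)" for c
  proof (cases "c \<in> set cs")
    case True
    then show ?thesis using \<rho>(1) row by simp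
  next
    case False
    then have "{v \<in> V. \<kappa> v = c} = {}" "\<alpha> c = 0"
      using \<kappa>(1) support by auto
    then show ?thesis by (simp add: color_row_def)
  qed
  moreover have "set cs \<subseteq> {1..}"
    unfolding support[symmetric] using \<alpha>_0 by (auto simp: Suc_le_eq intro!: gr0I)
  then have "\<kappa> \<in> V \<rightarrow>\<^sub>E {1..}"
    using \<kappa>(1) by (auto simp: PiE_iff)
  moreover have "color_word cs \<kappa> = xs"
    unfolding color_word_def \<rho>(2) using row by (simp cong: map_cong)
  ultimately show ?thesis
    using that colorings_with_content_iff by blast
qed

lemma chrom_qsym_coeff_eq_block_weight: "chrom_qsym_coeff V inc \<alpha> = block_weight (map \<alpha> cs) 0"
proof -
  let ?K = "colorings_with_content V inc \<alpha>"
    and ?L = "conc_list (map (\<lambda>c. chain_words (\<alpha> c)) cs) \<inter> permutations_of_set V"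
  have "color_word cs ` ?K = ?L"
    using color_word_in_conc_list word_is_color_word by blast
  then have "bij_betw (color_word cs) ?K ?L"
    using inj_on_color_word by (simp add: bij_betw_def)
  then have "weight (conc_list (map (\<lambda>c. chain_words (\<alpha> c)) cs)) =
      (\<Sum>\<kappa> \<in> ?K. monom 1 (inv_word (color_word cs \<kappa>)))"
    unfolding weight_def by (rule sum.reindex_bij_betw[symmetric])
  also have "\<dots> = chrom_qsym_coeff V inc \<alpha>"
    unfolding chrom_qsym_coeff_def
    by (intro sum.cong refl)
       (simp add: inv_word_color_word[OF _ cs permutations_of_setD(1)[OF color_word_in_conc_list(2)]])
  finally show ?thesis by (simp add: block_weight_def comp_def)
qed

end

lemma two_column_content_if_coloring:
  assumes \<kappa>: "\<kappa> \<in> colorings_with_content V inc \<alpha>"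
  shows "two_column_content (card V) \<alpha>"
proof -
  have content: "card {v \<in> V. \<kappa> v = c} = \<alpha> c" for c
    using \<kappa> by (simp add: colorings_with_content_def)
  have "{v \<in> V. \<kappa> v = 0} = {}"
    using \<kappa> by (force simp: colorings_with_content_iff PiE_iff)
  then have "\<alpha> 0 = 0"
    using content[of 0] by (simp only: card.empty)
  moreover have "\<alpha> c \<le> 2" for c
  proof (rule ccontr)
    assume "\<not> \<alpha> c \<le> 2"
    then have "chain_words (\<alpha> c) = {}"
      using chain_words_ge_3 by simp
    then show False
      using \<kappa> colorings_with_content_iff by blast
  qed
  moreover have "(\<Sum>c | \<alpha> c \<noteq> 0. \<alpha> c) = card V"
  proof -
    have "{c. \<alpha> c \<noteq> 0} = \<kappa> ` V"
      unfolding content[symmetric] by (auto simp: card_eq_0_iff)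
    then show ?thesis
      using sum.image_gen[of V "\<lambda>_. 1 :: nat" \<kappa>] content by simp
  qed
  ultimately show ?thesis by (simp add: two_column_content_def)
qed

lemma chrom_qsym_coeff_two_column:
  assumes \<alpha>: "two_column_content (card V) \<alpha>" and fin: "finite {c. \<alpha> c \<noteq> 0}"
  shows "chrom_qsym_coeff V inc \<alpha> =
    block_weight (replicate (card {c. \<alpha> c = 2}) 2 @ replicate (card {c. \<alpha> c = 1}) 1) 0"
proof -
  define cs where "cs = rev (sorted_list_of_set {c. \<alpha> c \<noteq> 0})"
  have cs: "sorted_wrt (\<lambda>x y. y < x) cs" "{c. \<alpha> c \<noteq> 0} = set cs" "distinct cs"
    using fin by (simp_all add: cs_def sorted_wrt_rev)
  have image_class:
    "image_mset \<alpha> (mset_set {c. \<alpha> c = k}) = replicate_mset (card {c. \<alpha> c = k}) k" for k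
  proof -
    have "image_mset \<alpha> (mset_set {c. \<alpha> c = k}) = image_mset (\<lambda>_. k) (mset_set {c. \<alpha> c = k})"
      by (cases "finite {c. \<alpha> c = k}") (auto intro: image_mset_cong)
    then show ?thesis by (simp add: image_mset_const_eq)
  qed
  have "mset (map \<alpha> cs) = image_mset \<alpha> (mset_set {c. \<alpha> c \<noteq> 0})"
    unfolding cs(2) by (simp add: mset_set_set[OF cs(3)])
  also have "\<dots> = image_mset \<alpha> (mset_set {c. \<alpha> c = 2}) + image_mset \<alpha> (mset_set {c. \<alpha> c = 1})"
    unfolding two_column_content_support[OF \<alpha>] image_mset_union[symmetric]
    by (intro arg_cong[where f = "image_mset \<alpha>"] mset_set_Union)
       (auto intro: finite_subset[OF _ fin])
  also have "\<dots> = mset (replicate (card {c. \<alpha> c = 2}) 2 @ replicate (card {c. \<alpha> c = 1}) 1)"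
    by (simp add: image_class)
  finally have "block_weight (map \<alpha> cs) 0 =
      block_weight (replicate (card {c. \<alpha> c = 2}) 2 @ replicate (card {c. \<alpha> c = 1}) 1) 0"
    by (rule block_weight_mset_cong)
  then show ?thesis
    using chrom_qsym_coeff_eq_block_weight[OF cs(1,2)] \<alpha> by (simp add: two_column_content_def)
qed

lemma chrom_qsym_coeff_expansion:
  assumes fin: "finite {c. \<alpha> c \<noteq> 0}"
  shows "chrom_qsym_coeff V inc \<alpha> =
    (\<Sum>l = 0..card V div 2. smult (int (e_coeff [card V - l, l] \<alpha>)) (bar_weight l))"
proof (cases "two_column_content (card V) \<alpha>")
  case True
  let ?d = "card {c. \<alpha> c = 2}" and ?p = "card {c. \<alpha> c = 1}"
  have "chrom_qsym_coeff V inc \<alpha> =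
      (\<Sum>l = 0..card V div 2. smult (coeff (e2_e1_h ?d ?p 0) l) (bar_weight l))"
    using chrom_qsym_coeff_two_column[OF True fin] two_column_content_card(2)[OF True fin]
      block_weight_expansion[of ?d ?p 0] by simp
  also have "\<dots> = (\<Sum>l = 0..card V div 2. smult (int (e_coeff [card V - l, l] \<alpha>)) (bar_weight l))"
    using True fin by (intro sum.cong refl) (simp add: e_coeff_two_column)
  finally show ?thesis .
next
  case False
  then have "colorings_with_content V inc \<alpha> = {}"
    using two_column_content_if_coloring by blast
  moreover have "e_coeff [card V - l, l] \<alpha> = 0" if "l \<in> {0..card V div 2}" for l
    using that False two_column_content_if_e_coeff[of "card V - l" l \<alpha>] by auto
  ultimately show ?thesis by (simp add: chrom_qsym_coeff_def)
qed

end

section \<open>Tableaux as words\<close>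

lemma map_in_permutations_of_set_iff:
  assumes "distinct cs"
  shows "map T cs \<in> permutations_of_set V \<longleftrightarrow> bij_betw T (set cs) V"
  using assms by (auto simp: permutations_of_set_def bij_betw_def distinct_map)

lemma bij_betw_map_list:
  assumes cs: "distinct cs" and len: "length cs = card V"
  shows "bij_betw (\<lambda>T. map T cs) {T \<in> extensional (set cs). map T cs \<in> permutations_of_set V}
    (permutations_of_set V)"
proof (rule bij_betw_imageI)
  show "inj_on (\<lambda>T. map T cs) {T \<in> extensional (set cs). map T cs \<in> permutations_of_set V}"
    by (auto intro!: inj_onI intro: extensionalityI)
  have "xs \<in> (\<lambda>T. map T cs) ` {T \<in> extensional (set cs). map T cs \<in> permutations_of_set V}"
    if xs: "xs \<in> permutations_of_set V" for xs
  proof -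
    define T where "T = restrict (\<lambda>c. the (map_of (zip cs xs) c)) (set cs)"
    have "length cs = length xs"
      using length_finite_permutations_of_set[OF xs] len by simp
    then have "map T cs = xs"
      using cs by (intro nth_equalityI) (auto simp: T_def map_of_zip_nth)
    moreover have "T \<in> extensional (set cs)"
      by (simp add: T_def)
    ultimately show ?thesis using xs by blast
  qed
  then show "(\<lambda>T. map T cs) ` {T \<in> extensional (set cs). map T cs \<in> permutations_of_set V} =
      permutations_of_set V"
    by auto
qed

text \<open>Rows are read from right to left, so that a row of length two becomes a descent.\<close>

definition reading_cells :: "nat \<Rightarrow> nat \<Rightarrow> (nat \<times> nat) list" where
  "reading_cells n l =
     concat (map (\<lambda>i. [(i, 2), (i, 1)]) [1..<Suc l]) @ map (\<lambda>i. (i, 1)) [Suc l..<Suc (n - l)]"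

definition reading_order :: "nat \<times> nat \<Rightarrow> nat \<times> nat \<Rightarrow> bool" where
  "reading_order c d \<longleftrightarrow> fst c < fst d \<or> fst c = fst d \<and> snd d < snd c"

lemma asymp_reading_order: "asymp reading_order"
  by (rule asympI) (auto simp: reading_order_def)

lemma young_cells_shape_21:
  assumes "2 * l \<le> n"
  shows "(i, j) \<in> young_cells (shape_21 n l) \<longleftrightarrow>
    1 \<le> i \<and> i \<le> l \<and> (j = 1 \<or> j = 2) \<or> l < i \<and> i \<le> n - l \<and> j = 1"
  using assms by (auto simp: young_cells_def shape_21_def nth_append)

lemma set_reading_cells:
  assumes "2 * l \<le> n"
  shows "set (reading_cells n l) = young_cells (shape_21 n l)"
  by (auto simp: reading_cells_def young_cells_shape_21[OF assms] image_iff simp del: upt_Suc)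

lemma length_reading_cells:
  assumes "2 * l \<le> n"
  shows "length (reading_cells n l) = n"
  using assms by (simp add: reading_cells_def length_concat comp_def sum_list_triv del: upt_Suc)

lemma sorted_reading_cells: "sorted_wrt reading_order (reading_cells n l)"
proof -
  have "sorted_wrt reading_order (concat (map (\<lambda>i. [(i, 2), (i, 1)]) [1..<Suc l]))"
    by (induction l) (auto simp: sorted_wrt_append reading_order_def)
  moreover have "sorted_wrt reading_order (map (\<lambda>i. (i, 1)) [Suc l..<Suc (n - l)])"
    using sorted_wrt_upt by (auto simp: sorted_wrt_map reading_order_def simp del: upt_Suc)
  ultimately show ?thesis
    by (auto simp: reading_cells_def sorted_wrt_append reading_order_def simp del: upt_Suc)
qed

lemma distinct_reading_cells: "distinct (reading_cells n l)"
  using sorted_reading_cells asymp_reading_order by (rule distinct_if_sorted_wrt)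

lemma map_reading_cells:
  "map T (reading_cells n l) =
    concat (map (\<lambda>i. [T (i, 2), T (i, 1)]) [1..<Suc l]) @ map (\<lambda>i. T (i, 1)) [Suc l..<Suc (n - l)]"
  by (simp add: reading_cells_def map_concat comp_def del: upt_Suc)

lemma successively_upt_iff:
  "successively P [a..<b] \<longleftrightarrow> (\<forall>i. a \<le> i \<and> Suc i < b \<longrightarrow> P i (Suc i))"
proof
  assume P: "successively P [a..<b]"
  show "\<forall>i. a \<le> i \<and> Suc i < b \<longrightarrow> P i (Suc i)"
  proof (intro allI impI)
    fix i assume "a \<le> i \<and> Suc i < b"
    then obtain k where "i = a + k" "Suc k < b - a"
      by (auto dest!: le_Suc_ex)
    then show "P i (Suc i)"
      using successively_nth[OF P, of k] by simp
  qed
qed (auto simp: successively_conv_nth)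

context height_two_interval_order begin

lemma concat_in_pair_words_iff:
  "concat (map (\<lambda>i. [g i, f i]) rs) \<in> pair_words (length rs) \<longleftrightarrow> (\<forall>i\<in>set rs. f i \<prec> g i)"
  unfolding pair_words_def by (induction rs) (auto simp: chain_words_2_conc)

lemma map_upt_in_descent_free_iff:
  "map f [a..<b] \<in> descent_free (b - a) \<longleftrightarrow> (\<forall>i. a \<le> i \<and> Suc i < b \<longrightarrow> \<not> f (Suc i) \<prec> f i)"
  by (simp add: descent_free_def successively_map successively_upt_iff)

lemma dominated_map_upt_iff:
  "dominated (map f [a..<b]) \<longleftrightarrow> (\<exists>s. a < s \<and> s < b \<and> (\<forall>i\<in>{a..<s}. f i \<prec> f s))"
proof
  assume "dominated (map f [a..<b])"
  then obtain s where s: "1 \<le> s" "s < b - a" "\<And>i. i < s \<Longrightarrow> f (a + i) \<prec> f (a + s)"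
    by (auto simp: dominated_def)
  have "f i \<prec> f (a + s)" if "i \<in> {a..<a + s}" for i
    using s(3)[of "i - a"] that by auto
  then show "\<exists>s. a < s \<and> s < b \<and> (\<forall>i\<in>{a..<s}. f i \<prec> f s)"
    using s(1,2) by (intro exI[of _ "a + s"]) auto
next
  assume "\<exists>s. a < s \<and> s < b \<and> (\<forall>i\<in>{a..<s}. f i \<prec> f s)"
  then obtain s where "a < s" "s < b" "\<forall>i\<in>{a..<s}. f i \<prec> f s" by blast
  then show "dominated (map f [a..<b])"
    unfolding dominated_def by (intro exI[of _ "s - a"]) auto
qed

end

text \<open>The ground set is a parameter because inside terms the simplifier turns \<open>{1..n}\<close> into
  \<open>{Suc 0..n}\<close>, and instances of the locale constants at the two forms would not match.\<close>

locale height_two_nuio = height_two_interval_order_nat V "nuio_less m n" for V m n +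
  assumes V_eq: "V = {1..n}"
begin

abbreviation P_less :: "nat \<Rightarrow> nat \<Rightarrow> bool" (infix "\<prec>" 50) where
  "x \<prec> y \<equiv> nuio_less m n x y"

lemma card_V: "card V = n"
  by (simp add: V_eq)

lemma inc_eq_inc_edge: "inc = inc_edge m n"
  unfolding fun_eq_iff inc_def unfolding inc_edge_def nuio_less_def V_eq by auto

text \<open>Within the two-element rows the column condition follows from the row condition, since
  chains have at most two elements.\<close>

lemma P_tableau_shape_21_iff:
  assumes l: "2 * l \<le> n"
  shows "P_tableau m n (shape_21 n l) T \<longleftrightarrow>
    T \<in> extensional (young_cells (shape_21 n l)) \<and> bij_betw T (young_cells (shape_21 n l)) V \<and>
    (\<forall>i\<in>{1..l}. T (i, 1) \<prec> T (i, 2)) \<and>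
    (\<forall>i. Suc l \<le> i \<and> Suc i < Suc (n - l) \<longrightarrow> \<not> T (Suc i, 1) \<prec> T (i, 1))"
proof -
  let ?Y = "young_cells (shape_21 n l)"
  let ?R = "\<forall>i\<in>{1..l}. T (i, 1) \<prec> T (i, 2)"
    and ?C = "\<forall>i. Suc l \<le> i \<and> Suc i < Suc (n - l) \<longrightarrow> \<not> T (Suc i, 1) \<prec> T (i, 1)"
  note Y = young_cells_shape_21[OF l]
  have entries: "T \<in> ?Y \<rightarrow>\<^sub>E V \<and> bij_betw T ?Y V \<longleftrightarrow> T \<in> extensional ?Y \<and> bij_betw T ?Y V"
    using bij_betwE[of T ?Y V] by (auto simp: PiE_iff)
  have rows: "(\<forall>i j. (i, j) \<in> ?Y \<and> (i, j + 1) \<in> ?Y \<longrightarrow> T (i, j) \<prec> T (i, j + 1)) \<longleftrightarrow> ?R"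
    by (auto simp: Y numeral_2_eq_2)
  have columns: "(\<forall>i j. (i, j) \<in> ?Y \<and> (i + 1, j) \<in> ?Y \<longrightarrow> \<not> T (i + 1, j) \<prec> T (i, j)) \<longleftrightarrow> ?C" if ?R
  proof
    assume C: ?C
    show "\<forall>i j. (i, j) \<in> ?Y \<and> (i + 1, j) \<in> ?Y \<longrightarrow> \<not> T (i + 1, j) \<prec> T (i, j)"
    proof (intro allI impI)
      fix i j assume "(i, j) \<in> ?Y \<and> (i + 1, j) \<in> ?Y"
      then consider "i \<in> {1..l}" "j = 1" | "i + 1 \<in> {1..l}" "j = 2"
        | "Suc l \<le> i" "Suc i < Suc (n - l)" "j = 1"
        unfolding Y by auto
      then show "\<not> T (i + 1, j) \<prec> T (i, j)"
      proof cases
        case 1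
        then show ?thesis using \<open>?R\<close> not_prec_chain by blast
      next
        case 2
        then have "T (i + 1, 1) \<prec> T (i + 1, 2)" using \<open>?R\<close> by blast
        then show ?thesis using 2 not_prec_chain by blast
      next
        case 3
        then show ?thesis using C by simp
      qed
    qed
  qed (use l in \<open>auto simp: Y\<close>)
  show ?thesis
    unfolding P_tableau_def V_eq[symmetric] rows using entries columns by blast
qed

lemma tableaux_bar_iff:
  assumes l: "2 * l \<le> n"
  shows "T \<in> tableaux_bar m n l \<longleftrightarrow>
    T \<in> extensional (set (reading_cells n l)) \<and>
    map T (reading_cells n l) \<in> permutations_of_set V \<inter> bar_words l"
proof -
  let ?singles = "map (\<lambda>i. T (i, 1)) [Suc l..<Suc (n - l)]"
    and ?pairs = "concat (map (\<lambda>i. [T (i, 2), T (i, 1)]) [1..<Suc l])"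
  have shape_length: "length (shape_21 n l) = n - l"
    using l by (simp add: shape_21_def)
  have pairs: "?pairs \<in> pair_words l \<longleftrightarrow> (\<forall>i\<in>{1..l}. T (i, 1) \<prec> T (i, 2))"
    using concat_in_pair_words_iff[of "\<lambda>i. T (i, 2)" "\<lambda>i. T (i, 1)" "[1..<Suc l]"]
    by (auto simp del: upt_Suc)
  have singles: "?singles \<in> descent_free (n - 2 * l) \<longleftrightarrow>
      (\<forall>i. Suc l \<le> i \<and> Suc i < Suc (n - l) \<longrightarrow> \<not> T (Suc i, 1) \<prec> T (i, 1))"
    using map_upt_in_descent_free_iff[of "\<lambda>i. T (i, 1)" "Suc l" "Suc (n - l)"] l
    by (simp add: mult_2 del: upt_Suc)
  have "length ?pairs = 2 * l"
    by (simp add: length_concat comp_def sum_list_triv del: upt_Suc)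
  then have split: "map T (reading_cells n l) \<in> bar_words l \<longleftrightarrow>
      ?pairs \<in> pair_words l \<and> ?singles \<in> descent_free (n - 2 * l) \<and> \<not> dominated ?singles"
    unfolding bar_words_def map_reading_cells conc_fixed_length_iff[OF length_pair_words] card_V
    by (simp del: upt_Suc)
  have dominated: "dominated ?singles \<longleftrightarrow>
      (\<exists>s. l + 2 \<le> s \<and> s \<le> n - l \<and> (\<forall>i \<in> {l + 1..<s}. T (i, 1) \<prec> T (s, 1)))"
    unfolding dominated_map_upt_iff by (simp add: Suc_le_eq less_Suc_eq_le)
  show ?thesis
    unfolding tableaux_bar_def mem_Collect_eq Int_iff P_tableau_shape_21_iff[OF l]
      split pairs singles dominated
      map_in_permutations_of_set_iff[OF distinct_reading_cells] set_reading_cells[OF l] shape_length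
    by blast
qed

lemma inv_G_eq_inv_word:
  assumes l: "2 * l \<le> n" and T: "P_tableau m n (shape_21 n l) T"
  shows "inv_G m n (shape_21 n l) T = inv_word (map T (reading_cells n l))"
proof -
  let ?Y = "young_cells (shape_21 n l)"
  let ?I = "{(c, d). c \<in> ?Y \<and> d \<in> ?Y \<and> reading_order d c \<and> inc (T c) (T d)}"
  have "inj_on T ?Y"
    using T by (simp add: P_tableau_def bij_betw_def)
  then have "inj_on (map_prod T T) ?I"
    by (auto simp: inj_on_def)
  have same_row: "\<not> inc (T c) (T d)" if "c \<in> ?Y" "d \<in> ?Y" "fst c = fst d" "snd c < snd d" for c d
  proof -
    have "T c \<prec> T d"
      using that T unfolding P_tableau_shape_21_iff[OF l]
      by (cases c; cases d) (auto simp: young_cells_shape_21[OF l])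
    then show ?thesis by (rule prec_not_inc)
  qed
  have "{(u, v). inc u v \<and>
      (\<exists>i j i' j'. (i, j) \<in> ?Y \<and> (i', j') \<in> ?Y \<and> T (i, j) = u \<and> T (i', j') = v \<and> i' < i)} =
      map_prod T T ` ?I"
    using same_row by (force simp: reading_order_def)
  then have "inv_G m n (shape_21 n l) T = card ?I"
    using \<open>inj_on (map_prod T T) ?I\<close> by (simp add: inv_G_def inc_eq_inc_edge card_image)
  also have "\<dots> = inv_word (map T (reading_cells n l))"
    using inversions_map_sorted_wrt[OF sorted_reading_cells asymp_reading_order, of inc T n l]
    by (simp add: set_reading_cells[OF l])
  finally show ?thesis .
qed

lemma C_coeff_eq_bar_weight:
  assumes l: "2 * l \<le> n"
  shows "C_coeff m n l = bar_weight l"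
proof -
  let ?word = "\<lambda>T. map T (reading_cells n l)"
  have "length (reading_cells n l) = card V"
    using length_reading_cells[OF l] card_V by simp
  note bij_betw_map_list[OF distinct_reading_cells this]
  moreover have "tableaux_bar m n l =
      {T \<in> {T \<in> extensional (set (reading_cells n l)). ?word T \<in> permutations_of_set V}.
        ?word T \<in> bar_words l}"
    using tableaux_bar_iff[OF l] by blast
  ultimately have "bij_betw ?word (tableaux_bar m n l) {w \<in> permutations_of_set V. w \<in> bar_words l}"
    by (simp only: bij_betw_Collect)
  then have "bar_weight l = (\<Sum>T \<in> tableaux_bar m n l. monom 1 (inv_word (?word T)))"
    unfolding bar_weight_def weight_def
    by (subst sum.reindex_bij_betw[symmetric]) (auto simp: Int_def conj_commute)
  also have "\<dots> = C_coeff m n l"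
    unfolding C_coeff_def
    by (intro sum.cong refl) (simp add: inv_G_eq_inv_word[OF l] tableaux_bar_def)
  finally show ?thesis ..
qed

lemma chrom_qsym_coeff_eq_sum_C_coeff:
  assumes "finite {c. \<alpha> c \<noteq> 0}"
  shows "chrom_qsym_coeff {1..n} (inc_edge m n) \<alpha> =
    (\<Sum>l = 0..n div 2. smult (int (e_coeff [n - l, l] \<alpha>)) (C_coeff m n l))"
  using chrom_qsym_coeff_expansion[OF assms]
  unfolding inc_eq_inc_edge card_V V_eq[symmetric] by (simp add: C_coeff_eq_bar_weight)

end

lemma height_two_nuio:
  fixes m :: "nat \<Rightarrow> nat" and n r :: nat
  assumes nuio: "\<forall>i \<in> {1..n - 1}. i \<le> m i \<and> m i \<le> n"
    and mono: "\<forall>i j. 1 \<le> i \<and> i \<le> j \<and> j \<le> n - 1 \<longrightarrow> m i \<le> m j"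
    and m1: "m 1 = r" and rn: "r < n" and mr: "m (r + 1) = n"
  shows "height_two_nuio {1..n} m n"
proof -
  have crosses: "x \<le> r" "r < y" if "nuio_less m n x y" for x y
  proof -
    have x: "1 \<le> x" "x \<le> n - 1" "m x < y" "y \<le> n"
      using that by (auto simp: nuio_less_def)
    then show "r < y"
      using mono[rule_format, of 1 x] m1 by simp
    show "x \<le> r"
    proof (rule ccontr)
      assume "\<not> x \<le> r"
      then have "m (r + 1) \<le> m x"
        using mono x by simp
      then show False using mr x by simp
    qed
  qed
  show ?thesis
  proof unfold_locales
    fix a b x assume ab: "nuio_less m n a b"
    then have a: "a \<in> {1..n - 1}" "m a < b" "b \<le> n"
      by (auto simp: nuio_less_def)
    then show "a \<in> {1..n} \<and> b \<in> {1..n} \<and> a < b"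
      using nuio by force
    show "\<not> nuio_less m n b x"
      using crosses[OF ab] crosses[of b x] by linarith
    assume x: "x \<in> {1..n}" "\<not> nuio_less m n x b" "\<not> nuio_less m n a x"
    have "\<not> x \<le> a"
      using mono[rule_format, of x a] x(1,2) a by (auto simp: nuio_less_def)
    moreover have "\<not> b \<le> x"
      using x(1,3) a by (auto simp: nuio_less_def)
    ultimately show "a < x \<and> x < b" by simp
  qed simp_all
qed

theorem theorem3p3:
  fixes m :: "nat \<Rightarrow> nat" and n r :: nat
  assumes nuio: "\<forall>i \<in> {1..n - 1}. i \<le> m i \<and> m i \<le> n"
    and mono: "\<forall>i j. 1 \<le> i \<and> i \<le> j \<and> j \<le> n - 1 \<longrightarrow> m i \<le> m j"
    and m1: "m 1 = r" and rn: "r < n" and mr: "m (r + 1) = n"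
  shows "\<exists>k > 0.
     (\<forall>\<alpha> :: nat \<Rightarrow> nat. finite {c. \<alpha> c \<noteq> 0} \<longrightarrow>
        chrom_qsym_coeff {1..n} (inc_edge m n) \<alpha> =
          (\<Sum>l = 0..k. smult (int (e_coeff [n - l, l] \<alpha>)) (C_coeff m n l))) \<and>
     (\<forall>l \<le> k. \<forall>d. coeff (C_coeff m n l) d \<ge> 0)"
proof -
  interpret height_two_nuio "{1..n}" m n
    using assms by (rule height_two_nuio)
  have "n \<ge> 2"
  proof (rule ccontr)
    assume "\<not> n \<ge> 2"
    then have "n = 1" "r = 0" using rn by auto
    then show False using m1 mr by simp
  qed
  then have "n div 2 > 0" by simp
  moreover have "coeff (C_coeff m n l) d \<ge> 0" for l d
    unfolding C_coeff_def coeff_sum by (intro sum_nonneg) simp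
  ultimately show ?thesis using chrom_qsym_coeff_eq_sum_C_coeff by blast
qed

end
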